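(* There is an algorithm which, given a proof in propositional orthologic of a sequent $\Gamma,\Delta$ (with $\Gamma,\Delta$ each either empty or a single annotated formula, viewed as an ordered pair $(\Gamma,\Delta)$), computes a formula $I$ (an interpolant for $(\Gamma,\Delta)$) such that $\mathrm{FV}(I)\subseteq\mathrm{FV}(\Gamma)\cap\mathrm{FV}(\Delta)$ and both sequents $\Gamma,I^R$ and $I^L,\Delta$ are provable. The algorithm runs in time linear in the size of the given proof.
   Context: Formulas of propositional orthologic are built from variables, constants $0,1$, and $\land,\lor,\neg$ ($\land,\lor$ commutative); $\mathrm{FV}$ denotes the set of variables occurring (in the formulas of a sequent; empty for an empty sequent). An annotated formula is $\phi^L$ or $\phi^R$; a sequent is a set of at most two annotated formulas; $\Gamma,\Delta,\Pi$ denote sets of zero or one annotated formula. Provability is derivability with the rules: Hyp: $\phi^L,\phi^R$. Cut: from $\Gamma,\psi^R$ and $\psi^L,\Delta$ infer $\Gamma,\Delta$. Weaken: from $\Gamma$ infer $\Gamma,\Delta$. LeftAnd: from $\Gamma,\phi^L$ infer $\Gamma,(\phi\land\psi)^L$. RightAnd: from $\Gamma,\phi^R$ and $\Gamma,\psi^R$ infer $\Gamma,(\phi\land\psi)^R$. LeftOr: from $\Gamma,\phi^L$ and $\Gamma,\psi^L$ infer $\Gamma,(\phi\lor\psi)^L$. RightOr: from $\Gamma,\phi^R$ infer $\Gamma,(\phi\lor\psi)^R$. LeftNot: from $\Gamma,\phi^R$ infer $\Gamma,(\neg\phi)^L$. RightNot: from $\Gamma,\phi^L$ infer $\Gamma,(\neg\phi)^R$.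 *)

theory Defs
  imports Main "HOL-Library.Uprod"
begin

section \<open>Formulas and sequents of orthologic\<close>

text \<open>
  Conjunction and disjunction are commutative: a binary connective is applied to an
  unordered pair, so that \<open>And \<phi> \<psi> = And \<psi> \<phi>\<close> holds as an equation between formulas.
\<close>

datatype form =
    Var nat
  | Zero
  | One
  | AndU "form uprod"
  | OrU "form uprod"
  | Neg form

abbreviation And :: "form \<Rightarrow> form \<Rightarrow> form" where
  "And \<phi> \<psi> \<equiv> AndU (Upair \<phi> \<psi>)"

abbreviation Or :: "form \<Rightarrow> form \<Rightarrow> form" where
  "Or \<phi> \<psi> \<equiv> OrU (Upair \<phi> \<psi>)"

primrec fv :: "form \<Rightarrow> nat set" where
  "fv (Var x) = {x}"
| "fv Zero = {}"
| "fv One = {}"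
| "fv (AndU p) = \<Union> (set_uprod (map_uprod fv p))"
| "fv (OrU p) = \<Union> (set_uprod (map_uprod fv p))"
| "fv (Neg \<phi>) = fv \<phi>"

lift_definition add_commute :: "(nat, nat) commute" is "(+)"
  by (simp add: add.commute)

lemma apply_add_commute [simp]: "apply_commute add_commute m n = m + n"
  by transfer simp

primrec fsize :: "form \<Rightarrow> nat" where
  "fsize (Var x) = 1"
| "fsize Zero = 1"
| "fsize One = 1"
| "fsize (AndU p) = Suc (case_uprod add_commute (map_uprod fsize p))"
| "fsize (OrU p) = Suc (case_uprod add_commute (map_uprod fsize p))"
| "fsize (Neg \<phi>) = Suc (fsize \<phi>)"

datatype aform = L (form_of: form) | R (form_of: form)

text \<open>
  A set of zero or one annotated formula is an element of type \<open>aform option\<close>, read as a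
  set through \<open>set_option\<close>. Sequents are unions of two such sets.
\<close>

type_synonym sequent = "aform set"

definition seq_fv :: "sequent \<Rightarrow> nat set" where
  "seq_fv S = (\<Union>\<chi>\<in>S. fv (form_of \<chi>))"

definition seq_size :: "sequent \<Rightarrow> nat" where
  "seq_size S = (\<Sum>\<chi>\<in>S. fsize (form_of \<chi>))"


section \<open>Proofs\<close>

text \<open>A proof is a derivation tree; every node carries the instance of the rule applied there.\<close>

datatype deriv =
    Hyp form
  | Cut "aform option" "aform option" form deriv deriv
  | Weaken "aform option" "aform option" deriv
  | LeftAnd "aform option" form form deriv
  | RightAnd "aform option" form form deriv deriv
  | LeftOr "aform option" form form deriv deriv
  | RightOr "aform option" form form deriv
  | LeftNot "aform option" form deriv
  | RightNot "aform option" form deriv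

text \<open>The sequent at the root of a derivation.\<close>

primrec concl :: "deriv \<Rightarrow> sequent" where
  "concl (Hyp \<phi>) = {L \<phi>, R \<phi>}"
| "concl (Cut \<Gamma> \<Delta> \<psi> d e) = set_option \<Gamma> \<union> set_option \<Delta>"
| "concl (Weaken \<Gamma> \<Delta> d) = set_option \<Gamma> \<union> set_option \<Delta>"
| "concl (LeftAnd \<Gamma> \<phi> \<psi> d) = set_option \<Gamma> \<union> {L (And \<phi> \<psi>)}"
| "concl (RightAnd \<Gamma> \<phi> \<psi> d e) = set_option \<Gamma> \<union> {R (And \<phi> \<psi>)}"
| "concl (LeftOr \<Gamma> \<phi> \<psi> d e) = set_option \<Gamma> \<union> {L (Or \<phi> \<psi>)}"
| "concl (RightOr \<Gamma> \<phi> \<psi> d) = set_option \<Gamma> \<union> {R (Or \<phi> \<psi>)}"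
| "concl (LeftNot \<Gamma> \<phi> d) = set_option \<Gamma> \<union> {L (Neg \<phi>)}"
| "concl (RightNot \<Gamma> \<phi> d) = set_option \<Gamma> \<union> {R (Neg \<phi>)}"

text \<open>Correctness of a derivation: the premises have the shape that the rules require.\<close>

primrec is_proof :: "deriv \<Rightarrow> bool" where
  "is_proof (Hyp \<phi>) \<longleftrightarrow> True"
| "is_proof (Cut \<Gamma> \<Delta> \<psi> d e) \<longleftrightarrow>
     is_proof d \<and> concl d = set_option \<Gamma> \<union> {R \<psi>} \<and>
     is_proof e \<and> concl e = {L \<psi>} \<union> set_option \<Delta>"
| "is_proof (Weaken \<Gamma> \<Delta> d) \<longleftrightarrow>
     is_proof d \<and> concl d = set_option \<Gamma>"
| "is_proof (LeftAnd \<Gamma> \<phi> \<psi> d) \<longleftrightarrow>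
     is_proof d \<and> concl d = set_option \<Gamma> \<union> {L \<phi>}"
| "is_proof (RightAnd \<Gamma> \<phi> \<psi> d e) \<longleftrightarrow>
     is_proof d \<and> concl d = set_option \<Gamma> \<union> {R \<phi>} \<and>
     is_proof e \<and> concl e = set_option \<Gamma> \<union> {R \<psi>}"
| "is_proof (LeftOr \<Gamma> \<phi> \<psi> d e) \<longleftrightarrow>
     is_proof d \<and> concl d = set_option \<Gamma> \<union> {L \<phi>} \<and>
     is_proof e \<and> concl e = set_option \<Gamma> \<union> {L \<psi>}"
| "is_proof (RightOr \<Gamma> \<phi> \<psi> d) \<longleftrightarrow>
     is_proof d \<and> concl d = set_option \<Gamma> \<union> {R \<phi>}"
| "is_proof (LeftNot \<Gamma> \<phi> d) \<longleftrightarrow>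
     is_proof d \<and> concl d = set_option \<Gamma> \<union> {R \<phi>}"
| "is_proof (RightNot \<Gamma> \<phi> d) \<longleftrightarrow>
     is_proof d \<and> concl d = set_option \<Gamma> \<union> {L \<phi>}"

definition proves :: "deriv \<Rightarrow> sequent \<Rightarrow> bool" where
  "proves d S \<longleftrightarrow> is_proof d \<and> concl d = S"

definition provable :: "sequent \<Rightarrow> bool" where
  "provable S \<longleftrightarrow> (\<exists>d. proves d S)"

text \<open>
  The size of a derivation is the number of symbols (variables, constants and connectives) in
  all its sequents, plus one symbol (the name of the rule) for every inference.
\<close>

primrec dsize :: "deriv \<Rightarrow> nat" where
  "dsize (Hyp \<phi>) = Suc (seq_size (concl (Hyp \<phi>)))"
| "dsize (Cut \<Gamma> \<Delta> \<psi> d e) = Suc (seq_size (concl (Cut \<Gamma> \<Delta> \<psi> d e)) + dsize d + dsize e)"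
| "dsize (Weaken \<Gamma> \<Delta> d) = Suc (seq_size (concl (Weaken \<Gamma> \<Delta> d)) + dsize d)"
| "dsize (LeftAnd \<Gamma> \<phi> \<psi> d) = Suc (seq_size (concl (LeftAnd \<Gamma> \<phi> \<psi> d)) + dsize d)"
| "dsize (RightAnd \<Gamma> \<phi> \<psi> d e) = Suc (seq_size (concl (RightAnd \<Gamma> \<phi> \<psi> d e)) + dsize d + dsize e)"
| "dsize (LeftOr \<Gamma> \<phi> \<psi> d e) = Suc (seq_size (concl (LeftOr \<Gamma> \<phi> \<psi> d e)) + dsize d + dsize e)"
| "dsize (RightOr \<Gamma> \<phi> \<psi> d) = Suc (seq_size (concl (RightOr \<Gamma> \<phi> \<psi> d)) + dsize d)"
| "dsize (LeftNot \<Gamma> \<phi> d) = Suc (seq_size (concl (LeftNot \<Gamma> \<phi> d)) + dsize d)"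
| "dsize (RightNot \<Gamma> \<phi> d) = Suc (seq_size (concl (RightNot \<Gamma> \<phi> d)) + dsize d)"

definition interpolant :: "form \<Rightarrow> aform option \<Rightarrow> aform option \<Rightarrow> bool" where
  "interpolant I \<Gamma> \<Delta> \<longleftrightarrow>
     fv I \<subseteq> seq_fv (set_option \<Gamma>) \<inter> seq_fv (set_option \<Delta>) \<and>
     provable (set_option \<Gamma> \<union> {R I}) \<and>
     provable ({L I} \<union> set_option \<Delta>)"


section \<open>The model of computation\<close>

text \<open>
  Algorithms are first-order recursive programs over S-expressions (pure Lisp). A program is
  a list of function bodies; \<open>Arg i\<close> is the \<open>i\<close>-th argument of the function being evaluated.
  Each evaluation step costs one unit; in particular one unit pays for a single cons, car or
  cdr, for a function call (in addition to its arguments and its body), and for comparing two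
  atoms, but there is no primitive that compares or copies compound S-expressions.
  The atom 0 plays the role of false. Errors (such as the car of an atom) have no value.
\<close>

datatype sexp = Atom nat | SCons sexp sexp

datatype expr =
    Arg nat
  | Quote sexp
  | MkCons expr expr
  | Car expr
  | Cdr expr
  | IsAtom expr
  | EqAtom expr expr
  | Cond expr expr expr
  | Call nat "expr list"

type_synonym program = "expr list"

definition sbool :: "bool \<Rightarrow> sexp" where
  "sbool b = Atom (if b then 1 else 0)"

text \<open>
  \<open>eval p env e v n\<close>: in the program \<open>p\<close>, with the arguments \<open>env\<close>, the expression \<open>e\<close>
  evaluates to \<open>v\<close> at cost \<open>n\<close>.
\<close>

inductive
  eval :: "program \<Rightarrow> sexp list \<Rightarrow> expr \<Rightarrow> sexp \<Rightarrow> nat \<Rightarrow> bool" and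
  evals :: "program \<Rightarrow> sexp list \<Rightarrow> expr list \<Rightarrow> sexp list \<Rightarrow> nat \<Rightarrow> bool"
  for p :: program
where
  Arg: "i < length env \<Longrightarrow> eval p env (Arg i) (env ! i) 1"
| Quote: "eval p env (Quote s) s 1"
| MkCons: "eval p env e s m \<Longrightarrow> eval p env f t n \<Longrightarrow>
    eval p env (MkCons e f) (SCons s t) (Suc (m + n))"
| Car: "eval p env e (SCons s t) n \<Longrightarrow> eval p env (Car e) s (Suc n)"
| Cdr: "eval p env e (SCons s t) n \<Longrightarrow> eval p env (Cdr e) t (Suc n)"
| IsAtom: "eval p env e s n \<Longrightarrow>
    eval p env (IsAtom e) (sbool (\<exists>a. s = Atom a)) (Suc n)"
| EqAtom: "eval p env e s m \<Longrightarrow> eval p env f t n \<Longrightarrow>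
    eval p env (EqAtom e f) (sbool (\<exists>a. s = Atom a \<and> t = Atom a)) (Suc (m + n))"
| Cond_true: "eval p env e s m \<Longrightarrow> s \<noteq> Atom 0 \<Longrightarrow> eval p env f v n \<Longrightarrow>
    eval p env (Cond e f g) v (Suc (m + n))"
| Cond_false: "eval p env e (Atom 0) m \<Longrightarrow> eval p env g v n \<Longrightarrow>
    eval p env (Cond e f g) v (Suc (m + n))"
| Call: "evals p env es vs m \<Longrightarrow> k < length p \<Longrightarrow> eval p vs (p ! k) v n \<Longrightarrow>
    eval p env (Call k es) v (Suc (m + n))"
| evals_Nil: "evals p env [] [] 0"
| evals_Cons: "eval p env e v m \<Longrightarrow> evals p env es vs n \<Longrightarrow>
    evals p env (e # es) (v # vs) (m + n)"

text \<open>Both the result and the cost of an evaluation are unique.\<close>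

lemma eval_deterministic:
  "eval p env e v m \<Longrightarrow> eval p env e w n \<Longrightarrow> v = w \<and> m = n"
  "evals p env es vs m \<Longrightarrow> evals p env es ws n \<Longrightarrow> vs = ws \<and> m = n"
proof (induction arbitrary: w n and ws n rule: eval_evals.inducts)
  case (Arg i env)
  then show ?case by (auto elim: eval.cases)
next
  case (Quote env s)
  then show ?case by (auto elim: eval.cases)
next
  case (MkCons env e s m f t k)
  from MkCons.prems show ?case by cases (use MkCons.IH in blast)
next
  case (Car env e s t k)
  from Car.prems show ?case by cases (use Car.IH in blast)
next
  case (Cdr env e s t k)
  from Cdr.prems show ?case by cases (use Cdr.IH in blast)
next
  case (IsAtom env e s k)
  from IsAtom.prems show ?case by cases (use IsAtom.IH in blast)
next
  case (EqAtom env e s m f t k)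
  from EqAtom.prems show ?case by cases (use EqAtom.IH in blast)
next
  case (Cond_true env e s m f v k g)
  from Cond_true.prems show ?case by cases (use Cond_true in blast)+
next
  case (Cond_false env e m g v k f)
  from Cond_false.prems show ?case by cases (use Cond_false in blast)+
next
  case (Call env es vs m k v j)
  from Call.prems show ?case by cases (use Call.IH in blast)
next
  case (evals_Nil env)
  then show ?case by (auto elim: evals.cases)
next
  case (evals_Cons env e v m es vs k)
  from evals_Cons.prems show ?case by cases (use evals_Cons.IH in blast)
qed

primrec ssize :: "sexp \<Rightarrow> nat" where
  "ssize (Atom a) = 1"
| "ssize (SCons s t) = Suc (ssize s + ssize t)"

text \<open>
  The function with index 0 is the main function; it has one argument, the input. Values may
  share substructures during an evaluation, but the output has to be written out in full, and
  this is charged as part of the running time.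
\<close>

definition runs :: "program \<Rightarrow> sexp \<Rightarrow> sexp \<Rightarrow> nat \<Rightarrow> bool" where
  "runs p input output t \<longleftrightarrow>
     p \<noteq> [] \<and> (\<exists>n. eval p [input] (p ! 0) output n \<and> t = n + ssize output)"


section \<open>Formulas and proofs as data\<close>

primrec slist :: "sexp list \<Rightarrow> sexp" where
  "slist [] = Atom 0"
| "slist (s # ss) = SCons s (slist ss)"

definition node :: "nat \<Rightarrow> sexp list \<Rightarrow> sexp" where
  "node k ss = SCons (Atom k) (slist ss)"

text \<open>
  An S-expression represents a formula up to the order of the arguments of the binary
  connectives, which a concrete expression has to fix in one way or the other.
\<close>

inductive represents :: "sexp \<Rightarrow> form \<Rightarrow> bool" where
  "represents (node 0 [Atom x]) (Var x)"
| "represents (node 1 []) Zero"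
| "represents (node 2 []) One"
| "represents s \<phi> \<Longrightarrow> represents t \<psi> \<Longrightarrow> represents (node 3 [s, t]) (And \<phi> \<psi>)"
| "represents s \<phi> \<Longrightarrow> represents t \<psi> \<Longrightarrow> represents (node 4 [s, t]) (Or \<phi> \<psi>)"
| "represents s \<phi> \<Longrightarrow> represents (node 5 [s]) (Neg \<phi>)"

text \<open>
  For the input of an algorithm, every formula is written as one fixed S-expression, so that
  equal formulas are written in the same way. The order in which the two arguments of a
  binary connective are written may be chosen freely, for each formula.
\<close>

definition coding :: "(form \<Rightarrow> sexp) \<Rightarrow> bool" where
  "coding enc \<longleftrightarrow>
     (\<forall>x. enc (Var x) = node 0 [Atom x]) \<and>
     enc Zero = node 1 [] \<and>
     enc One = node 2 [] \<and>
     (\<forall>\<phi> \<psi>. enc (And \<phi> \<psi>) \<in> {node 3 [enc \<phi>, enc \<psi>], node 3 [enc \<psi>, enc \<phi>]}) \<and>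
     (\<forall>\<phi> \<psi>. enc (Or \<phi> \<psi>) \<in> {node 4 [enc \<phi>, enc \<psi>], node 4 [enc \<psi>, enc \<phi>]}) \<and>
     (\<forall>\<phi>. enc (Neg \<phi>) = node 5 [enc \<phi>])"

lemma coding_represents:
  assumes "coding enc"
  shows "represents (enc \<phi>) \<phi>"
proof (induction \<phi>)
  case (AndU p)
  obtain a b where p: "p = Upair a b" by (cases p)
  have "represents (enc a) a" "represents (enc b) b"
    using AndU p by auto
  then have "represents (node 3 [enc a, enc b]) (And a b)"
    "represents (node 3 [enc b, enc a]) (And b a)"
    by (auto intro: represents.intros)
  moreover have "And b a = And a b" by simp
  ultimately show ?case using assms p unfolding coding_def
    by (metis empty_iff insert_iff)
next
  case (OrU p)
  obtain a b where p: "p = Upair a b" by (cases p)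
  have "represents (enc a) a" "represents (enc b) b"
    using OrU p by auto
  then have "represents (node 4 [enc a, enc b]) (Or a b)"
    "represents (node 4 [enc b, enc a]) (Or b a)"
    by (auto intro: represents.intros)
  moreover have "Or b a = Or a b" by simp
  ultimately show ?case using assms p unfolding coding_def
    by (metis empty_iff insert_iff)
qed (use assms in \<open>auto simp: coding_def simp del: One_nat_def intro: represents.intros\<close>)

primrec some_coding :: "form \<Rightarrow> sexp" where
  "some_coding (Var x) = node 0 [Atom x]"
| "some_coding Zero = node 1 []"
| "some_coding One = node 2 []"
| "some_coding (AndU p) =
     (SOME u. \<exists>s t. map_uprod some_coding p = Upair s t \<and> u = node 3 [s, t])"
| "some_coding (OrU p) =
     (SOME u. \<exists>s t. map_uprod some_coding p = Upair s t \<and> u = node 4 [s, t])"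
| "some_coding (Neg \<phi>) = node 5 [some_coding \<phi>]"

lemma coding_exists: "\<exists>enc. coding enc"
proof -
  have *: "(SOME u. \<exists>s t. Upair a b = Upair s t \<and> u = node k [s, t])
      \<in> {node k [a, b], node k [b, a]}" for a b k
    by (rule someI2[where a = "node k [a, b]"]) auto
  have "coding some_coding"
    unfolding coding_def
    by (intro conjI allI) (use * in \<open>simp_all only: some_coding.simps map_uprod_simps\<close>)
  then show ?thesis by blast
qed

primrec enc_aform :: "(form \<Rightarrow> sexp) \<Rightarrow> aform \<Rightarrow> sexp" where
  "enc_aform enc (L \<phi>) = node 0 [enc \<phi>]"
| "enc_aform enc (R \<phi>) = node 1 [enc \<phi>]"

primrec enc_opt :: "(form \<Rightarrow> sexp) \<Rightarrow> aform option \<Rightarrow> sexp" where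
  "enc_opt enc None = slist []"
| "enc_opt enc (Some \<chi>) = slist [enc_aform enc \<chi>]"

primrec enc_deriv :: "(form \<Rightarrow> sexp) \<Rightarrow> deriv \<Rightarrow> sexp" where
  "enc_deriv enc (Hyp \<phi>) = node 0 [enc \<phi>]"
| "enc_deriv enc (Cut \<Gamma> \<Delta> \<psi> d e) =
     node 1 [enc_opt enc \<Gamma>, enc_opt enc \<Delta>, enc \<psi>, enc_deriv enc d, enc_deriv enc e]"
| "enc_deriv enc (Weaken \<Gamma> \<Delta> d) =
     node 2 [enc_opt enc \<Gamma>, enc_opt enc \<Delta>, enc_deriv enc d]"
| "enc_deriv enc (LeftAnd \<Gamma> \<phi> \<psi> d) =
     node 3 [enc_opt enc \<Gamma>, enc \<phi>, enc \<psi>, enc_deriv enc d]"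
| "enc_deriv enc (RightAnd \<Gamma> \<phi> \<psi> d e) =
     node 4 [enc_opt enc \<Gamma>, enc \<phi>, enc \<psi>, enc_deriv enc d, enc_deriv enc e]"
| "enc_deriv enc (LeftOr \<Gamma> \<phi> \<psi> d e) =
     node 5 [enc_opt enc \<Gamma>, enc \<phi>, enc \<psi>, enc_deriv enc d, enc_deriv enc e]"
| "enc_deriv enc (RightOr \<Gamma> \<phi> \<psi> d) =
     node 6 [enc_opt enc \<Gamma>, enc \<phi>, enc \<psi>, enc_deriv enc d]"
| "enc_deriv enc (LeftNot \<Gamma> \<phi> d) =
     node 7 [enc_opt enc \<Gamma>, enc \<phi>, enc_deriv enc d]"
| "enc_deriv enc (RightNot \<Gamma> \<phi> d) =
     node 8 [enc_opt enc \<Gamma>, enc \<phi>, enc_deriv enc d]"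

definition enc_input ::
  "(form \<Rightarrow> sexp) \<Rightarrow> aform option \<Rightarrow> aform option \<Rightarrow> deriv \<Rightarrow> sexp" where
  "enc_input enc \<Gamma> \<Delta> d = slist [enc_opt enc \<Gamma>, enc_opt enc \<Delta>, enc_deriv enc d]"

end

theory Submission
  imports Defs
begin

text \<open>
  An interpolant for \<open>\<Gamma>, \<Delta>\<close> is obtained by pushing \<open>\<Gamma>\<close> through the proof, without eliminating
  cuts. A skeleton of a formula replaces some of its subformulas by falsity, or by truth
  where the subformula is valid (dually on negative positions), so it implies the formula. From a
  proof of \<open>\<phi> \<le> \<psi>\<close> and a skeleton \<open>\<phi>'\<close> of \<open>\<phi>\<close> one computes, by recursion on the proof,
  a skeleton \<open>\<psi>'\<close> of \<open>\<psi>\<close> with \<open>\<phi>' \<le> \<psi>'\<close> and \<open>fv \<psi>' \<subseteq> fv \<phi>'\<close>: a cut is the composition of two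
  such steps, and at a rule with two premises that acts on \<open>\<phi>\<close> the two results are joined
  position by position. Started at \<open>\<phi>' = \<phi>\<close>, this gives
  \<open>\<phi> \<le> \<psi>' \<le> \<psi>\<close> with \<open>fv \<psi>' \<subseteq> fv \<phi> \<inter> fv \<psi>\<close>. Skeletons never outgrow the formulas of
  the sequent at hand, so every inference costs time linear in the size of its sequent.
\<close>

section \<open>Symbolic execution of programs\<close>

text \<open>The obstacle is the cut. Interpolants for its two premises share their variables with
  the cut formula, so neither need stay within both \<open>\<Gamma>\<close> and
  \<open>\<Delta>\<close>, and eliminating cuts first would mean rebuilding the proof. Hence the
  stronger induction: the second premise is entered with the skeleton computed from the first, not
  with the cut formula itself, so variables can only disappear along the way. Each subproof is
  entered at most once. The results have to be skeletons rather than arbitrary formulas because a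
  later rule acting on a connective of the source must find that connective in the skeleton, or a
  marker in its place. A disjunction of two results for one target would lose this shape and would
  also grow. Falsity alone is not enough as a replacement: if the source was added by weakening, it
  may be consistent and share no variable with the target. Then truth is the answer, licensed by the
  validity of the target.\<close>

inductive_cases eval_ArgE: "eval p env (Arg i) v n"
inductive_cases eval_QuoteE: "eval p env (Quote s) v n"
inductive_cases eval_MkConsE: "eval p env (MkCons e f) v n"
inductive_cases eval_CarE: "eval p env (Car e) v n"
inductive_cases eval_CdrE: "eval p env (Cdr e) v n"
inductive_cases eval_IsAtomE: "eval p env (IsAtom e) v n"
inductive_cases eval_EqAtomE: "eval p env (EqAtom e f) v n"
inductive_cases eval_CondE: "eval p env (Cond e f g) v n"
inductive_cases eval_CallE: "eval p env (Call k es) v n"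
inductive_cases evals_NilE: "evals p env [] vs n"
inductive_cases evals_ConsE: "evals p env (e # es) vs n"

text \<open>Evaluation is deterministic, hence the graph of a partial function. As a function it can
  be computed by rewriting, which turns statements about values and costs into simplifier
  goals.\<close>

definition run :: "program \<Rightarrow> sexp list \<Rightarrow> expr \<Rightarrow> (sexp \<times> nat) option" where
  "run p env e =
     (if \<exists>v n. eval p env e v n then Some (SOME r. eval p env e (fst r) (snd r)) else None)"

definition run_list :: "program \<Rightarrow> sexp list \<Rightarrow> expr list \<Rightarrow> (sexp list \<times> nat) option" where
  "run_list p env es =
     (if \<exists>vs n. evals p env es vs n then Some (SOME r. evals p env es (fst r) (snd r)) else None)"

text \<open>Rewriting with the equations for \<open>run\<close> stops at this constant, so a
  recursive program is not unfolded forever; each function body is opened deliberately.\<close>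

definition call :: "program \<Rightarrow> nat \<Rightarrow> sexp list \<Rightarrow> (sexp \<times> nat) option" where
  "call p k vs = (if k < length p then run p vs (p ! k) else None)"

lemma run_iff: "run p env e = Some (v, n) \<longleftrightarrow> eval p env e v n"
proof
  assume "run p env e = Some (v, n)"
  then have "\<exists>r. eval p env e (fst r) (snd r)" "(SOME r. eval p env e (fst r) (snd r)) = (v, n)"
    by (auto simp: run_def split: if_splits)
  then show "eval p env e v n"
    by (metis (mono_tags, lifting) fst_conv snd_conv someI_ex)
next
  assume ev: "eval p env e v n"
  then have "(SOME r. eval p env e (fst r) (snd r)) = (v, n)"
    by (intro some_equality) (auto dest: eval_deterministic(1) intro!: prod_eqI)
  with ev show "run p env e = Some (v, n)" by (auto simp: run_def)
qed

lemma run_list_iff: "run_list p env es = Some (vs, n) \<longleftrightarrow> evals p env es vs n"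
proof
  assume "run_list p env es = Some (vs, n)"
  then have "\<exists>r. evals p env es (fst r) (snd r)" "(SOME r. evals p env es (fst r) (snd r)) = (vs, n)"
    by (auto simp: run_list_def split: if_splits)
  then show "evals p env es vs n"
    by (metis (mono_tags, lifting) fst_conv snd_conv someI_ex)
next
  assume ev: "evals p env es vs n"
  then have "(SOME r. evals p env es (fst r) (snd r)) = (vs, n)"
    by (intro some_equality) (auto dest: eval_deterministic(2) intro!: prod_eqI)
  with ev show "run_list p env es = Some (vs, n)" by (auto simp: run_list_def)
qed

lemma option_pair_eqI:
  assumes "\<And>v n. x = Some (v, n) \<longleftrightarrow> y = Some (v, n)"
  shows "x = y"
  using assms by (metis not_Some_eq surj_pair)

lemma run_iffs:
  "run p env (Arg i) = Some (v, n) \<longleftrightarrow> i < length env \<and> v = env ! i \<and> n = 1"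
  "run p env (Quote s) = Some (v, n) \<longleftrightarrow> v = s \<and> n = 1"
  "run p env (MkCons e f) = Some (v, n) \<longleftrightarrow> (\<exists>s t k l. run p env e = Some (s, k) \<and>
     run p env f = Some (t, l) \<and> v = SCons s t \<and> n = Suc (k + l))"
  "run p env (Car e) = Some (v, n) \<longleftrightarrow> (\<exists>t k. run p env e = Some (SCons v t, k) \<and> n = Suc k)"
  "run p env (Cdr e) = Some (v, n) \<longleftrightarrow> (\<exists>s k. run p env e = Some (SCons s v, k) \<and> n = Suc k)"
  "run p env (IsAtom e) = Some (v, n) \<longleftrightarrow>
     (\<exists>s k. run p env e = Some (s, k) \<and> v = sbool (\<exists>a. s = Atom a) \<and> n = Suc k)"
  "run p env (EqAtom e f) = Some (v, n) \<longleftrightarrow> (\<exists>s t k l. run p env e = Some (s, k) \<and>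
     run p env f = Some (t, l) \<and> v = sbool (\<exists>a. s = Atom a \<and> t = Atom a) \<and> n = Suc (k + l))"
  "run p env (Cond e f g) = Some (v, n) \<longleftrightarrow> (\<exists>s k l. run p env e = Some (s, k) \<and>
     run p env (if s = Atom 0 then g else f) = Some (v, l) \<and> n = Suc (k + l))"
  "run p env (Call j es) = Some (v, n) \<longleftrightarrow> (\<exists>vs k l. run_list p env es = Some (vs, k) \<and>
     call p j vs = Some (v, l) \<and> n = Suc (k + l))"
  "run_list p env [] = Some (vs, n) \<longleftrightarrow> vs = [] \<and> n = 0"
  "run_list p env (e # es) = Some (vs, n) \<longleftrightarrow> (\<exists>w ws k l. run p env e = Some (w, k) \<and>
     run_list p env es = Some (ws, l) \<and> vs = w # ws \<and> n = k + l)"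
  unfolding call_def run_iff run_list_iff
  by (auto intro: eval_evals.intros split: if_splits simp: run_iff simp del: One_nat_def
      elim!: eval_ArgE eval_QuoteE eval_MkConsE eval_CarE eval_CdrE eval_IsAtomE
        eval_EqAtomE eval_CondE eval_CallE evals_NilE evals_ConsE)

lemma run_simps:
  "run p env (Arg i) = (if i < length env then Some (env ! i, 1) else None)"
  "run p env (Quote s) = Some (s, 1)"
  "run p env (MkCons e f) = (case run p env e of None \<Rightarrow> None | Some (s, m) \<Rightarrow>
     (case run p env f of None \<Rightarrow> None | Some (t, n) \<Rightarrow> Some (SCons s t, Suc (m + n))))"
  "run p env (Car e) = (case run p env e of None \<Rightarrow> None | Some (s, m) \<Rightarrow>
     (case s of Atom a \<Rightarrow> None | SCons t u \<Rightarrow> Some (t, Suc m)))"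
  "run p env (Cdr e) = (case run p env e of None \<Rightarrow> None | Some (s, m) \<Rightarrow>
     (case s of Atom a \<Rightarrow> None | SCons t u \<Rightarrow> Some (u, Suc m)))"
  "run p env (IsAtom e) = (case run p env e of None \<Rightarrow> None | Some (s, m) \<Rightarrow>
     Some (sbool (\<exists>a. s = Atom a), Suc m))"
  "run p env (EqAtom e f) = (case run p env e of None \<Rightarrow> None | Some (s, m) \<Rightarrow>
     (case run p env f of None \<Rightarrow> None | Some (t, n) \<Rightarrow>
       Some (sbool (\<exists>a. s = Atom a \<and> t = Atom a), Suc (m + n))))"
  "run p env (Cond e f g) = (case run p env e of None \<Rightarrow> None | Some (s, m) \<Rightarrow>
     (case run p env (if s = Atom 0 then g else f) of None \<Rightarrow> None | Some (t, n) \<Rightarrow>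
       Some (t, Suc (m + n))))"
  "run p env (Call k es) = (case run_list p env es of None \<Rightarrow> None | Some (vs, m) \<Rightarrow>
     (case call p k vs of None \<Rightarrow> None | Some (t, n) \<Rightarrow> Some (t, Suc (m + n))))"
  "run_list p env [] = Some ([], 0)"
  "run_list p env (e # es) = (case run p env e of None \<Rightarrow> None | Some (v, m) \<Rightarrow>
     (case run_list p env es of None \<Rightarrow> None | Some (vs, n) \<Rightarrow> Some (v # vs, m + n)))"
  by (rule option_pair_eqI; simp only: run_iffs; auto split: option.splits sexp.splits if_splits; fail)+


section \<open>The program\<close>

abbreviation "field1 e \<equiv> Car (Cdr e)"
abbreviation "field2 e \<equiv> Car (Cdr (Cdr e))"
abbreviation "field3 e \<equiv> Car (Cdr (Cdr (Cdr e)))"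
abbreviation "field4 e \<equiv> Car (Cdr (Cdr (Cdr (Cdr e))))"
abbreviation "field5 e \<equiv> Car (Cdr (Cdr (Cdr (Cdr (Cdr e)))))"
abbreviation "const k \<equiv> Quote (Atom k)"
abbreviation "mk_node1 k e \<equiv> MkCons k (MkCons e (const 0))"
abbreviation "mk_node2 k e f \<equiv> MkCons k (MkCons e (MkCons f (const 0)))"

definition true_code :: sexp where
  "true_code = node 4 [node 2 [], node 5 [node 2 []]]"

definition false_code :: sexp where
  "false_code = node 3 [node 2 [], node 5 [node 2 []]]"

text \<open>The source skeleton is the full code of the formula in \<open>\<Gamma>\<close>. The tag
  of an annotated formula serves directly as a truth value: 1 for right, 0 for left. If
  \<open>\<Delta>\<close> is a left formula, the skeleton obtained bounds it from above, and an
  interpolant is its negation. An empty side leaves no variables, so a constant is returned.\<close>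

definition main_body :: expr where
  "main_body =
     Cond (IsAtom (Car (Arg 0))) (Quote true_code)
    (Cond (IsAtom (field1 (Arg 0))) (Quote false_code)
    (Cond (Car (Car (field1 (Arg 0))))
      (Call 3 [Call 4 [field2 (Arg 0), Car (Car (Arg 0)), field1 (Car (Car (Arg 0))),
         Car (field1 (Arg 0))], const 1])
      (mk_node1 (const 5) (Call 3 [Call 4 [field2 (Arg 0), Car (Car (Arg 0)),
         field1 (Car (Car (Arg 0))), Car (field1 (Arg 0))], const 0]))))"

definition equal_body :: expr where
  "equal_body =
     Cond (IsAtom (Arg 0)) (EqAtom (Arg 0) (Arg 1))
    (Cond (IsAtom (Arg 1)) (const 0)
    (Cond (Call 1 [Car (Arg 0), Car (Arg 1)]) (Call 1 [Cdr (Arg 0), Cdr (Arg 1)]) (const 0)))"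

definition join_body :: expr where
  "join_body =
     Cond (IsAtom (Arg 0)) (Cond (Arg 0) (Arg 0) (Arg 1))
    (Cond (IsAtom (Arg 1)) (Cond (Arg 1) (Arg 1) (Arg 0))
    (MkCons (Call 2 [Car (Arg 0), Car (Arg 1)]) (Call 2 [Cdr (Arg 0), Cdr (Arg 1)])))"

text \<open>Markers are written out as formulas only here, at the end; before that they must remain
  atoms so that \<open>join\<close> can recognise them. The second argument is the side on which a
  marker is read, hence it flips under negation.\<close>

definition expand_body :: expr where
  "expand_body =
     Cond (IsAtom (Arg 0))
      (Cond (Arg 0)
        (Cond (Arg 1) (Quote true_code) (Quote false_code))
        (Cond (Arg 1) (Quote false_code) (Quote true_code)))
    (Cond (EqAtom (Car (Arg 0)) (const 5))
      (mk_node1 (const 5) (Call 3 [field1 (Arg 0), Cond (Arg 1) (const 0) (const 1)]))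
    (Cond (EqAtom (Car (Arg 0)) (const 3))
      (mk_node2 (const 3) (Call 3 [field1 (Arg 0), Arg 1]) (Call 3 [field2 (Arg 0), Arg 1]))
    (Cond (EqAtom (Car (Arg 0)) (const 4))
      (mk_node2 (const 4) (Call 3 [field1 (Arg 0), Arg 1]) (Call 3 [field2 (Arg 0), Arg 1]))
      (Arg 0))))"

text \<open>
  The arguments are a proof of \<open>\<Gamma>, \<Delta>\<close>, \<open>\<Gamma>\<close>, a skeleton of the formula of \<open>\<Gamma>\<close>, and \<open>\<Delta>\<close>. In
  the functions called from here, argument 4 tells whether the (first) context of the last
  inference is \<open>\<Gamma>\<close>, that is, whether the principal formula is in \<open>\<Delta>\<close>.
\<close>

definition flow_body :: expr where
  "flow_body =
     Cond (IsAtom (Arg 2)) (Arg 2)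
    (Cond (Call 1 [Arg 1, Arg 3]) (const 0)
    (Cond (EqAtom (Car (Arg 0)) (const 0)) (Arg 2)
    (Call 5 [Arg 0, Arg 1, Arg 2, Arg 3, Call 1 [Car (field1 (Arg 0)), Arg 1]])))"

text \<open>Weakening needs no recursion. If the retained formula is the source, the source is
  refuted by itself and falsity will do; otherwise the target is valid by itself and becomes truth.
  The extra argument for the negation rules is the tag of the active formula in the premise.\<close>

definition dispatch_body :: expr where
  "dispatch_body =
     Cond (EqAtom (Car (Arg 0)) (const 1)) (Call 6 [Arg 0, Arg 1, Arg 2, Arg 3, Arg 4])
    (Cond (EqAtom (Car (Arg 0)) (const 2)) (Cond (Arg 4) (const 0) (const 1))
    (Cond (EqAtom (Car (Arg 0)) (const 3)) (Call 7 [Arg 0, Arg 1, Arg 2, Arg 3, Arg 4])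
    (Cond (EqAtom (Car (Arg 0)) (const 6)) (Call 7 [Arg 0, Arg 1, Arg 2, Arg 3, Arg 4])
    (Cond (EqAtom (Car (Arg 0)) (const 4)) (Call 8 [Arg 0, Arg 1, Arg 2, Arg 3, Arg 4])
    (Cond (EqAtom (Car (Arg 0)) (const 5)) (Call 8 [Arg 0, Arg 1, Arg 2, Arg 3, Arg 4])
    (Cond (EqAtom (Car (Arg 0)) (const 7)) (Call 9 [Arg 0, Arg 1, Arg 2, Arg 3, Arg 4, const 1])
    (Call 9 [Arg 0, Arg 1, Arg 2, Arg 3, Arg 4, const 0])))))))"

definition cut_body :: expr where
  "cut_body =
     Cond (Arg 4)
      (Call 4 [field5 (Arg 0), mk_node1 (const 0) (field3 (Arg 0)),
         Call 4 [field4 (Arg 0), Arg 1, Arg 2, mk_node1 (const 1) (field3 (Arg 0))], Arg 3])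
      (Call 4 [field4 (Arg 0), mk_node1 (const 1) (field3 (Arg 0)),
         Call 4 [field5 (Arg 0), Arg 1, Arg 2, mk_node1 (const 0) (field3 (Arg 0))], Arg 3])"

text \<open>A coding may write the components of a connective in either order; comparing codes finds
  the position of the active one. The premise says nothing about the other component, so in a target
  it is filled with the marker 0.\<close>

definition unary_body :: expr where
  "unary_body =
     Cond (Arg 4)
      (Cond (Call 1 [field2 (Arg 0), field1 (field1 (Arg 3))])
        (mk_node2 (Car (field1 (Arg 3)))
          (Call 4 [field4 (Arg 0), Arg 1, Arg 2, mk_node1 (Car (Arg 3)) (field2 (Arg 0))])
          (const 0))
        (mk_node2 (Car (field1 (Arg 3)))
          (const 0)
          (Call 4 [field4 (Arg 0), Arg 1, Arg 2, mk_node1 (Car (Arg 3)) (field2 (Arg 0))])))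
      (Call 4 [field4 (Arg 0), mk_node1 (Car (Arg 1)) (field2 (Arg 0)),
         Cond (Call 1 [field2 (Arg 0), field1 (field1 (Arg 1))])
           (field1 (Arg 2)) (field2 (Arg 2)),
         Arg 3])"

definition binary_body :: expr where
  "binary_body =
     Cond (Arg 4)
      (Cond (Call 1 [field2 (Arg 0), field1 (field1 (Arg 3))])
        (mk_node2 (Car (field1 (Arg 3)))
          (Call 4 [field4 (Arg 0), Arg 1, Arg 2, mk_node1 (Car (Arg 3)) (field2 (Arg 0))])
          (Call 4 [field5 (Arg 0), Arg 1, Arg 2, mk_node1 (Car (Arg 3)) (field3 (Arg 0))]))
        (mk_node2 (Car (field1 (Arg 3)))
          (Call 4 [field5 (Arg 0), Arg 1, Arg 2, mk_node1 (Car (Arg 3)) (field3 (Arg 0))])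
          (Call 4 [field4 (Arg 0), Arg 1, Arg 2, mk_node1 (Car (Arg 3)) (field2 (Arg 0))])))
      (Cond (Call 1 [field2 (Arg 0), field1 (field1 (Arg 1))])
        (Call 2 [
           Call 4 [field4 (Arg 0), mk_node1 (Car (Arg 1)) (field2 (Arg 0)), field1 (Arg 2), Arg 3],
           Call 4 [field5 (Arg 0), mk_node1 (Car (Arg 1)) (field3 (Arg 0)), field2 (Arg 2), Arg 3]])
        (Call 2 [
           Call 4 [field4 (Arg 0), mk_node1 (Car (Arg 1)) (field2 (Arg 0)), field2 (Arg 2), Arg 3],
           Call 4 [field5 (Arg 0), mk_node1 (Car (Arg 1)) (field3 (Arg 0)), field1 (Arg 2), Arg 3]]))"

definition neg_body :: expr where
  "neg_body =
     Cond (Arg 4)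
      (mk_node1 (const 5)
        (Call 4 [field3 (Arg 0), Arg 1, Arg 2, mk_node1 (Arg 5) (field2 (Arg 0))]))
      (Call 4 [field3 (Arg 0), mk_node1 (Arg 5) (field2 (Arg 0)), field1 (Arg 2), Arg 3])"

definition interp :: program where
  "interp = [main_body, equal_body, join_body, expand_body, flow_body, dispatch_body,
     cut_body, unary_body, binary_body, neg_body]"

section \<open>Values and costs of the individual functions\<close>

lemma call_interp:
  "call interp 0 vs = run interp vs main_body"
  "call interp (Suc 0) vs = run interp vs equal_body"
  "call interp 2 vs = run interp vs join_body"
  "call interp 3 vs = run interp vs expand_body"
  "call interp 4 vs = run interp vs flow_body"
  "call interp 5 vs = run interp vs dispatch_body"
  "call interp 6 vs = run interp vs cut_body"
  "call interp 7 vs = run interp vs unary_body"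
  "call interp 8 vs = run interp vs binary_body"
  "call interp 9 vs = run interp vs neg_body"
  by (simp_all add: call_def interp_def)

lemma sbool_eq_0 [simp]: "sbool b = Atom 0 \<longleftrightarrow> \<not> b"
  by (simp add: sbool_def)

text \<open>The recursion descends in both arguments simultaneously and stops at an atom of either,
  so the first argument alone bounds the cost; the factor 20 covers the fixed work per call.\<close>

lemma call_equal:
  "\<exists>n. call interp (Suc 0) [s, t] = Some (sbool (s = t), n) \<and> n \<le> 20 * ssize s"
proof (induction s arbitrary: t)
  case (Atom a)
  show ?case
    by (auto simp: call_interp(2) equal_body_def run_simps sbool_def)
next
  case (SCons s1 s2)
  show ?case
  proof (cases t)
    case (Atom b)
    then show ?thesis
      by (simp add: call_interp(2) equal_body_def run_simps) (simp add: sbool_def)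
  next
    case t: (SCons t1 t2)
    from SCons.IH obtain n1 n2 where
      "call interp (Suc 0) [s1, t1] = Some (sbool (s1 = t1), n1)" "n1 \<le> 20 * ssize s1"
      "call interp (Suc 0) [s2, t2] = Some (sbool (s2 = t2), n2)" "n2 \<le> 20 * ssize s2"
      by meson
    then show ?thesis
      \<comment> \<open>Only a call on two pairs is unfolded; the calls on the components do not
        match this instance and are left to the induction hypotheses.\<close>
      by (cases "s1 = t1")
        (simp_all add: t call_interp(2)[of "[SCons u v, SCons x y]" for u v x y]
          equal_body_def run_simps, simp add: sbool_def)
  qed
qed

text \<open>
  This ignores where formulas begin: two skeletons of the same formula agree on all atoms that
  are not markers, namely tags, variables and ends of lists, and \<open>join\<close> keeps such atoms.
\<close>

fun join :: "sexp \<Rightarrow> sexp \<Rightarrow> sexp" where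
  "join (Atom a) t = (if a = 0 then t else Atom a)"
| "join (SCons s1 s2) (Atom b) = (if b = 0 then SCons s1 s2 else Atom b)"
| "join (SCons s1 s2) (SCons t1 t2) = SCons (join s1 t1) (join s2 t2)"

lemma call_join:
  "\<exists>n. call interp 2 [s, t] = Some (join s t, n) \<and> n \<le> 20 * ssize s"
proof (induction s t rule: join.induct)
  case (3 s1 s2 t1 t2)
  then obtain n1 n2 where
    "call interp 2 [s1, t1] = Some (join s1 t1, n1)" "n1 \<le> 20 * ssize s1"
    "call interp 2 [s2, t2] = Some (join s2 t2, n2)" "n2 \<le> 20 * ssize s2"
    by blast
  then show ?case
    by (simp add: call_interp(3)[of "[SCons u v, SCons x y]" for u v x y] join_body_def run_simps)
qed (simp_all add: call_interp(3) join_body_def run_simps)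

lemma call_flow_marker:
  "\<exists>n. call interp 4 [d, \<Gamma>, Atom a, \<Delta>] = Some (Atom a, n) \<and> n \<le> 10"
  by (simp add: call_interp flow_body_def run_simps)

lemma call_flow_same:
  "\<exists>n. call interp 4 [d, \<Gamma>, SCons s t, \<Gamma>] = Some (Atom 0, n) \<and> n \<le> 20 * ssize \<Gamma> + 20"
proof -
  obtain n where "call interp (Suc 0) [\<Gamma>, \<Gamma>] = Some (sbool True, n)" "n \<le> 20 * ssize \<Gamma>"
    using call_equal[of \<Gamma> \<Gamma>] by auto
  then show ?thesis
    by (simp add: call_interp(5) flow_body_def run_simps)
qed

lemma call_flow_hyp:
  assumes "\<Gamma> \<noteq> \<Delta>"
  shows "\<exists>n. call interp 4 [node 0 ds, \<Gamma>, SCons s t, \<Delta>] = Some (SCons s t, n) \<and>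
    n \<le> 20 * ssize \<Gamma> + 20"
proof -
  obtain n where "call interp (Suc 0) [\<Gamma>, \<Delta>] = Some (sbool False, n)" "n \<le> 20 * ssize \<Gamma>"
    using call_equal[of \<Gamma> \<Delta>] assms by auto
  then show ?thesis
    by (simp add: call_interp(5) flow_body_def run_simps node_def)
qed

lemma call_flow_dispatch:
  assumes "\<Gamma> \<noteq> \<Delta>" "k \<noteq> 0"
    and "call interp 5 [node k (slist [\<Theta>] # ds), \<Gamma>, SCons s t, \<Delta>, sbool (\<Theta> = \<Gamma>)] = Some (v, l)"
  shows "\<exists>n. call interp 4 [node k (slist [\<Theta>] # ds), \<Gamma>, SCons s t, \<Delta>] = Some (v, n) \<and>
    n \<le> l + 20 * ssize \<Gamma> + 20 * ssize \<Theta> + 40"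
proof -
  obtain n where "call interp (Suc 0) [\<Gamma>, \<Delta>] = Some (sbool False, n)" "n \<le> 20 * ssize \<Gamma>"
    using call_equal[of \<Gamma> \<Delta>] assms by auto
  moreover obtain n' where "call interp (Suc 0) [\<Theta>, \<Gamma>] = Some (sbool (\<Theta> = \<Gamma>), n')"
      "n' \<le> 20 * ssize \<Theta>"
    using call_equal[of \<Theta> \<Gamma>] by auto
  ultimately show ?thesis using assms
    by (simp add: call_interp(5) flow_body_def run_simps node_def)
qed

lemma call_cut_left:
  assumes "call interp 4 [d, \<Gamma>, s, node 1 [\<psi>]] = Some (r, l)"
    and "call interp 4 [e, node 0 [\<psi>], r, \<Delta>] = Some (v, m)"
  shows "\<exists>n. call interp 5 [node 1 [g, h, \<psi>, d, e], \<Gamma>, s, \<Delta>, sbool True] = Some (v, n) \<and>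
    n \<le> l + m + 100"
  using assms
  by (simp add: call_interp(6,7) dispatch_body_def cut_body_def run_simps node_def)

lemma call_cut_right:
  assumes "call interp 4 [e, \<Gamma>, s, node 0 [\<psi>]] = Some (r, l)"
    and "call interp 4 [d, node 1 [\<psi>], r, \<Delta>] = Some (v, m)"
  shows "\<exists>n. call interp 5 [node 1 [g, h, \<psi>, d, e], \<Gamma>, s, \<Delta>, sbool False] = Some (v, n) \<and>
    n \<le> l + m + 100"
  using assms
  by (simp add: call_interp(6,7) dispatch_body_def cut_body_def run_simps node_def)

lemma call_weaken:
  "\<exists>n. call interp 5 [node 2 [g, h, d], \<Gamma>, s, \<Delta>, sbool q] = Some (sbool (\<not> q), n) \<and> n \<le> 100"
  by (simp add: call_interp(6) dispatch_body_def run_simps node_def, simp add: sbool_def)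

lemma call_unary_output:
  assumes "k \<in> {3, 6}"
    and "call interp 4 [d, \<Gamma>, s, node p [\<phi>]] = Some (r, l)"
  shows "\<exists>n. call interp 5 [node k [g, \<phi>, \<psi>, d], \<Gamma>, s, node p [node u [x, y]], sbool True] =
      Some (if \<phi> = x then node u [r, Atom 0] else node u [Atom 0, r], n) \<and>
    n \<le> l + 20 * ssize \<phi> + 200"
proof -
  obtain n where "call interp (Suc 0) [\<phi>, x] = Some (sbool (\<phi> = x), n)" "n \<le> 20 * ssize \<phi>"
    using call_equal by blast
  with assms show ?thesis
    by (auto simp: call_interp(6,8) dispatch_body_def unary_body_def run_simps node_def)
qed

lemma call_unary_input:
  assumes "k \<in> {3, 6}"
    and "call interp 4 [d, node p [\<phi>], if \<phi> = x then s else t, \<Delta>] = Some (v, l)"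
  shows "\<exists>n. call interp 5 [node k [g, \<phi>, \<psi>, d], node p [node u [x, y]], node w [s, t], \<Delta>,
      sbool False] = Some (v, n) \<and> n \<le> l + 20 * ssize \<phi> + 200"
proof -
  obtain n where "call interp (Suc 0) [\<phi>, x] = Some (sbool (\<phi> = x), n)" "n \<le> 20 * ssize \<phi>"
    using call_equal by blast
  with assms show ?thesis
    by (auto simp: call_interp(6,8) dispatch_body_def unary_body_def run_simps node_def)
qed

lemma call_binary_output:
  assumes "k \<in> {4, 5}"
    and "call interp 4 [d, \<Gamma>, s, node p [\<phi>]] = Some (r, l)"
    and "call interp 4 [e, \<Gamma>, s, node p [\<psi>]] = Some (r', l')"
  shows "\<exists>n. call interp 5 [node k [g, \<phi>, \<psi>, d, e], \<Gamma>, s, node p [node u [x, y]], sbool True] =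
      Some (if \<phi> = x then node u [r, r'] else node u [r', r], n) \<and>
    n \<le> l + l' + 20 * ssize \<phi> + 200"
proof -
  obtain n where "call interp (Suc 0) [\<phi>, x] = Some (sbool (\<phi> = x), n)" "n \<le> 20 * ssize \<phi>"
    using call_equal by blast
  with assms show ?thesis
    by (auto simp: call_interp(6,9) dispatch_body_def binary_body_def run_simps node_def)
qed

lemma call_binary_input:
  assumes "k \<in> {4, 5}"
    and "call interp 4 [d, node p [\<phi>], if \<phi> = x then s else t, \<Delta>] = Some (r, l)"
    and "call interp 4 [e, node p [\<psi>], if \<phi> = x then t else s, \<Delta>] = Some (r', l')"
  shows "\<exists>n. call interp 5 [node k [g, \<phi>, \<psi>, d, e], node p [node u [x, y]], node w [s, t], \<Delta>,
      sbool False] = Some (join r r', n) \<and>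
    n \<le> l + l' + 20 * ssize \<phi> + 20 * ssize r + 200"
proof -
  obtain n where "call interp (Suc 0) [\<phi>, x] = Some (sbool (\<phi> = x), n)" "n \<le> 20 * ssize \<phi>"
    using call_equal by blast
  moreover obtain n' where "call interp 2 [r, r'] = Some (join r r', n')" "n' \<le> 20 * ssize r"
    using call_join by blast
  ultimately show ?thesis using assms
    by (auto simp: call_interp(6,9) dispatch_body_def binary_body_def run_simps node_def)
qed

lemma call_neg_output:
  assumes "k \<in> {7, 8}"
    and "call interp 4 [d, \<Gamma>, s, node (if k = 7 then 1 else 0) [\<phi>]] = Some (r, l)"
  shows "\<exists>n. call interp 5 [node k [g, \<phi>, d], \<Gamma>, s, \<Delta>, sbool True] = Some (node 5 [r], n) \<and>
    n \<le> l + 200"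
  using assms
  by (auto simp: call_interp(6,10) dispatch_body_def neg_body_def run_simps node_def)

lemma call_neg_input:
  assumes "k \<in> {7, 8}"
    and "call interp 4 [d, node (if k = 7 then 1 else 0) [\<phi>], s, \<Delta>] = Some (v, l)"
  shows "\<exists>n. call interp 5 [node k [g, \<phi>, d], \<Gamma>, node w [s], \<Delta>, sbool False] = Some (v, n) \<and>
    n \<le> l + 200"
  using assms
  by (auto simp: call_interp(6,10) dispatch_body_def neg_body_def run_simps node_def)

lemma call_main_left_None:
  "\<exists>n. call interp 0 [slist [Atom 0, h, d]] = Some (true_code, n) \<and> n \<le> 100"
  by (simp add: call_interp(1) main_body_def run_simps)

lemma call_main_right_None:
  "\<exists>n. call interp 0 [slist [slist [g], Atom 0, d]] = Some (false_code, n) \<and> n \<le> 100"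
  by (simp add: call_interp(1) main_body_def run_simps)

lemma call_main:
  assumes "call interp 4 [d, node q [s], s, node (if b then 1 else 0) [w]] = Some (r, l)"
    and "call interp 3 [r, sbool b] = Some (u, m)"
  shows "\<exists>n. call interp 0 [slist [slist [node q [s]], slist [node (if b then 1 else 0) [w]], d]] =
      Some (if b then u else node 5 [u], n) \<and> n \<le> l + m + 100"
  using assms by (cases b) (simp_all add: call_interp(1) main_body_def run_simps node_def sbool_def)

lemma runs_interp:
  assumes "call interp 0 [input] = Some (out, n)"
  shows "runs interp input out (n + ssize out)"
  using assms by (auto simp: runs_def call_def run_iff interp_def split: if_splits)


section \<open>Derived rules\<close>

text \<open>With the side as a boolean, the left-right duality of the calculus is negation of
  booleans. Together with \<open>conn\<close> it merges \<open>LeftAnd\<close> with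
  \<open>RightOr\<close>, \<open>RightAnd\<close> with \<open>LeftOr\<close>, and
  \<open>LeftNot\<close> with \<open>RightNot\<close>, so each pair is treated once.\<close>

definition ann :: "bool \<Rightarrow> form \<Rightarrow> aform" where
  "ann b \<phi> = (if b then R \<phi> else L \<phi>)"

lemma ann_simps [simp]:
  "ann True \<phi> = R \<phi>" "ann False \<phi> = L \<phi>" "form_of (ann b \<phi>) = \<phi>"
  "ann a \<phi> = ann b \<psi> \<longleftrightarrow> a = b \<and> \<phi> = \<psi>"
  by (auto simp: ann_def)

lemma ex_ann: "\<exists>b \<phi>. \<chi> = ann b \<phi>"
  by (cases \<chi>) (metis ann_simps(1,2))+

definition conn :: "bool \<Rightarrow> form \<Rightarrow> form \<Rightarrow> form" where
  "conn c \<phi> \<psi> = (if c then Or \<phi> \<psi> else And \<phi> \<psi>)"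

lemma conn_simps [simp]:
  "conn True \<phi> \<psi> = Or \<phi> \<psi>" "conn False \<phi> \<psi> = And \<phi> \<psi>"
  "fv (conn c \<phi> \<psi>) = fv \<phi> \<union> fv \<psi>" "fsize (conn c \<phi> \<psi>) = Suc (fsize \<phi> + fsize \<psi>)"
  by (auto simp: conn_def)

lemma conn_commute: "conn c \<phi> \<psi> = conn c \<psi> \<phi>"
  by (simp add: conn_def)

lemma provableI: "is_proof d \<Longrightarrow> concl d = S \<Longrightarrow> provable S"
  by (auto simp: provable_def proves_def)

lemma provable_hyp: "provable {ann (\<not> b) \<phi>, ann b \<phi>}"
  by (rule provableI[of "Hyp \<phi>"]) (cases b; auto)+

lemma provable_cut:
  assumes "provable (set_option \<Gamma> \<union> {ann b \<psi>})" "provable (set_option \<Delta> \<union> {ann (\<not> b) \<psi>})"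
  shows "provable (set_option \<Gamma> \<union> set_option \<Delta>)"
proof -
  from assms obtain d e where "is_proof d" "concl d = set_option \<Gamma> \<union> {ann b \<psi>}"
    "is_proof e" "concl e = set_option \<Delta> \<union> {ann (\<not> b) \<psi>}"
    by (auto simp: provable_def proves_def)
  then show ?thesis
    by (intro provableI[of "if b then Cut \<Gamma> \<Delta> \<psi> d e else Cut \<Delta> \<Gamma> \<psi> e d"]) auto
qed

lemma provable_cut2:
  assumes "provable {\<chi>, ann b \<psi>}" "provable {ann (\<not> b) \<psi>, \<theta>}"
  shows "provable {\<chi>, \<theta>}"
  using provable_cut[of "Some \<chi>" b \<psi> "Some \<theta>"] assms by (simp add: insert_commute)

lemma provable_cut1:
  assumes "provable {ann b \<psi>}" "provable {ann (\<not> b) \<psi>, \<theta>}"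
  shows "provable {\<theta>}"
  using provable_cut[of "None" b \<psi> "Some \<theta>"] assms by (simp add: insert_commute)

lemma provable_weaken:
  assumes "provable {\<chi>}"
  shows "provable {\<chi>, \<theta>}" "provable {\<theta>, \<chi>}"
proof -
  from assms obtain d where "is_proof d" "concl d = {\<chi>}"
    by (auto simp: provable_def proves_def)
  then show "provable {\<chi>, \<theta>}"
    by (intro provableI[of "Weaken (Some \<chi>) (Some \<theta>) d"]) auto
  then show "provable {\<theta>, \<chi>}" by (simp add: insert_commute)
qed

lemma provable_unary:
  assumes "provable {\<chi>, ann b \<phi>}"
  shows "provable {\<chi>, ann b (conn b \<phi> \<psi>)}"
proof -
  from assms obtain d where "is_proof d" "concl d = {\<chi>, ann b \<phi>}"
    by (auto simp: provable_def proves_def)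
  then show ?thesis
    by (intro provableI[of "if b then RightOr (Some \<chi>) \<phi> \<psi> d else LeftAnd (Some \<chi>) \<phi> \<psi> d"]) auto
qed

lemma provable_unary':
  assumes "provable {\<chi>, ann b \<psi>}"
  shows "provable {\<chi>, ann b (conn b \<phi> \<psi>)}"
  using provable_unary[OF assms] conn_commute by metis

lemma provable_binary:
  assumes "provable {\<chi>, ann b \<phi>}" "provable {\<chi>, ann b \<psi>}"
  shows "provable {\<chi>, ann b (conn (\<not> b) \<phi> \<psi>)}"
proof -
  from assms obtain d e where "is_proof d" "concl d = {\<chi>, ann b \<phi>}"
      "is_proof e" "concl e = {\<chi>, ann b \<psi>}"
    by (auto simp: provable_def proves_def)
  then show ?thesis
    by (intro provableI[of "if b then RightAnd (Some \<chi>) \<phi> \<psi> d e else LeftOr (Some \<chi>) \<phi> \<psi> d e"]) auto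
qed

lemma provable_neg:
  assumes "provable {\<chi>, ann b \<phi>}"
  shows "provable {\<chi>, ann (\<not> b) (Neg \<phi>)}"
proof -
  from assms obtain d where "is_proof d" "concl d = {\<chi>, ann b \<phi>}"
    by (auto simp: provable_def proves_def)
  then show ?thesis
    by (intro provableI[of "if b then LeftNot (Some \<chi>) \<phi> d else RightNot (Some \<chi>) \<phi> d"]) auto
qed

text \<open>The two-premise rule has to come last: its shared context is the compound formula on the
  other side, which each branch first builds by a one-premise rule. Whether \<open>c = b\<close>
  decides on which side that rule acts.\<close>

lemma provable_conn_mono:
  assumes "provable {ann (\<not> b) \<phi>', ann b \<phi>}" "provable {ann (\<not> b) \<psi>', ann b \<psi>}"
  shows "provable {ann (\<not> b) (conn c \<phi>' \<psi>'), ann b (conn c \<phi> \<psi>)}"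
proof (cases "c = b")
  case True
  from assms have "provable {ann b (conn b \<phi> \<psi>), ann (\<not> b) \<phi>'}"
    "provable {ann b (conn b \<phi> \<psi>), ann (\<not> b) \<psi>'}"
    using provable_unary provable_unary' by (simp_all add: insert_commute)
  from provable_binary[OF this] True show ?thesis by (simp add: insert_commute)
next
  case False
  from assms have "provable {ann (\<not> b) (conn (\<not> b) \<phi>' \<psi>'), ann b \<phi>}"
    "provable {ann (\<not> b) (conn (\<not> b) \<phi>' \<psi>'), ann b \<psi>}"
    using provable_unary[of "ann b \<phi>" "\<not> b" \<phi>' \<psi>'] provable_unary'[of "ann b \<psi>" "\<not> b" \<psi>' \<phi>']
    by (simp_all add: insert_commute)
  from provable_binary[OF this] False show ?thesis by simp
qed

lemma provable_neg_mono:
  assumes "provable {ann b \<phi>', ann (\<not> b) \<phi>}"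
  shows "provable {ann (\<not> b) (Neg \<phi>'), ann b (Neg \<phi>)}"
  using provable_neg[OF assms] provable_neg[of "ann b (Neg \<phi>)" b \<phi>'] by (simp add: insert_commute)

text \<open>
  The calculus has no rules for the constants, so \<open>One\<close> acts as a variable that does not count
  in \<open>fv\<close>; truth and falsity are \<open>1 \<or> \<not>1\<close> and \<open>1 \<and> \<not>1\<close>.
\<close>

definition verum :: "bool \<Rightarrow> form" where
  "verum b = conn b One (Neg One)"

lemma fv_verum [simp]: "fv (verum b) = {}"
  by (simp add: verum_def)

text \<open>This is excluded middle for \<open>One\<close>, or dually non-contradiction. Both
  formulas of the hypothesis are enlarged to the same annotated formula; a sequent is a set, so they
  merge into one.\<close>

lemma provable_verum: "provable {ann b (verum b)}"
proof -
  have "provable {ann b One, ann b (Neg One)}"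
    using provable_neg[of "ann b One" "\<not> b" One] provable_hyp[of b One]
    by (simp add: insert_commute)
  then have "provable {ann b (verum b), ann b (Neg One)}"
    unfolding verum_def using provable_unary by (simp add: insert_commute)
  from provable_unary'[OF this, of One] show ?thesis
    by (simp add: verum_def)
qed

lemma provable_weaken_option:
  assumes "provable (set_option \<Gamma>)"
  shows "provable (set_option \<Gamma> \<union> set_option \<Delta>)"
proof -
  from assms obtain d where "is_proof d" "concl d = set_option \<Gamma>"
    by (auto simp: provable_def proves_def)
  then show ?thesis by (intro provableI[of "Weaken \<Gamma> \<Delta> d"]) auto
qed

lemma interpolant_left_None:
  assumes "provable (set_option \<Delta>)"
  shows "interpolant (verum True) None \<Delta>"
  using provable_weaken_option[OF assms, of "Some (L (verum True))"] provable_verum[of True]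
  by (simp add: interpolant_def)

lemma interpolant_right_None:
  assumes "provable (set_option \<Gamma>)"
  shows "interpolant (verum False) \<Gamma> None"
  using provable_weaken_option[OF assms, of "Some (R (verum False))"] provable_verum[of False]
  by (simp add: interpolant_def)

text \<open>The flow delivers \<open>\<delta>'\<close> on the side of \<open>\<delta>\<close>. When
  that is the left side, the two negation rules carry both sequents over to the orientation an
  interpolant requires.\<close>

lemma interpolant_ann:
  assumes "provable {\<chi>, ann b \<delta>'}" "provable {ann (\<not> b) \<delta>', ann b \<delta>}"
    and "fv \<delta>' \<subseteq> fv (form_of \<chi>)" "fv \<delta>' \<subseteq> fv \<delta>"
  shows "interpolant (if b then \<delta>' else Neg \<delta>') (Some \<chi>) (Some (ann b \<delta>))"
  using assms provable_neg[of \<chi> False \<delta>'] provable_neg[of "L \<delta>" True \<delta>']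
  by (cases b) (auto simp: interpolant_def seq_fv_def insert_commute)


section \<open>Skeletons\<close>

lemma node_eq_iff [simp]: "node k ss = node l ts \<longleftrightarrow> k = l \<and> ss = ts"
proof -
  have "slist ss = slist ts \<Longrightarrow> ss = ts" for ts
    by (induction ss arbitrary: ts) (case_tac ts; simp)+
  then show ?thesis by (auto simp: node_def)
qed

lemma node_neq_Atom [simp]: "node k ss \<noteq> Atom a" "Atom a \<noteq> node k ss"
  by (simp_all add: node_def)

lemma fsize_pos: "1 \<le> fsize \<phi>"
  by (cases \<phi>) auto

text \<open>This makes every coding injective, so that the equality test of the program on codes
  decides equality of formulas, commutativity included.\<close>

lemma represents_unique: "represents s \<phi> \<Longrightarrow> represents s \<psi> \<Longrightarrow> \<phi> = \<psi>"
proof (induction arbitrary: \<psi> rule: represents.induct)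
  case (4 s \<phi> t \<psi> \<chi>)
  from 4(5) obtain \<phi>' \<psi>' where "\<chi> = And \<phi>' \<psi>'" "represents s \<phi>'" "represents t \<psi>'"
    by (cases rule: represents.cases) (simp; blast)+
  with 4(3,4) show ?case by simp
next
  case (5 s \<phi> t \<psi> \<chi>)
  from 5(5) obtain \<phi>' \<psi>' where "\<chi> = Or \<phi>' \<psi>'" "represents s \<phi>'" "represents t \<psi>'"
    by (cases rule: represents.cases) (simp; blast)+
  with 5(3,4) show ?case by simp
next
  case (6 s \<phi> \<chi>)
  from 6(3) obtain \<phi>' where "\<chi> = Neg \<phi>'" "represents s \<phi>'"
    by (cases rule: represents.cases) simp_all
  with 6(2) show ?case by simp
qed (erule represents.cases; simp)+

definition ctag :: "bool \<Rightarrow> nat" where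
  "ctag c = (if c then 4 else 3)"

lemma represents_conn:
  "represents s \<phi> \<Longrightarrow> represents t \<psi> \<Longrightarrow> represents (node (ctag c) [s, t]) (conn c \<phi> \<psi>)"
  by (auto simp: ctag_def conn_def intro: represents.intros)

text \<open>
  \<open>skel enc b s \<phi>' \<phi>\<close>: the S-expression \<open>s\<close> arises from the code of \<open>\<phi>\<close> by replacing
  subformulas by the atoms 0 and 1, and it stands for the formula \<open>\<phi>'\<close>. For \<open>b\<close> true, \<open>\<phi>'\<close> lies below
  \<open>\<phi>\<close>, and the atoms 0 and 1 stand for falsity and truth; for \<open>b\<close> false everything is dual. So
  an atom keeps its reading when a skeleton of \<open>\<not>\<phi>\<close> on one side of a sequent is turned
  into one of \<open>\<phi>\<close> on the other side.
\<close>

inductive skel :: "(form \<Rightarrow> sexp) \<Rightarrow> bool \<Rightarrow> sexp \<Rightarrow> form \<Rightarrow> form \<Rightarrow> bool" for enc where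
  skel_0: "skel enc b (Atom 0) (verum (\<not> b)) \<phi>"
| skel_1: "provable {ann b \<phi>} \<Longrightarrow> skel enc b (Atom 1) (verum b) \<phi>"
| skel_Var: "skel enc b (node 0 [Atom x]) (Var x) (Var x)"
| skel_Zero: "skel enc b (node 1 []) Zero Zero"
| skel_One: "skel enc b (node 2 []) One One"
| skel_conn: "enc (conn c \<phi> \<psi>) = node (ctag c) [enc \<phi>, enc \<psi>] \<Longrightarrow>
    skel enc b s \<phi>' \<phi> \<Longrightarrow> skel enc b t \<psi>' \<psi> \<Longrightarrow>
    skel enc b (node (ctag c) [s, t]) (conn c \<phi>' \<psi>') (conn c \<phi> \<psi>)"
| skel_Neg: "skel enc (\<not> b) s \<phi>' \<phi> \<Longrightarrow> skel enc b (node 5 [s]) (Neg \<phi>') (Neg \<phi>)"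

lemma skel_provable: "skel enc b s \<phi>' \<phi> \<Longrightarrow> provable {ann (\<not> b) \<phi>', ann b \<phi>}"
proof (induction rule: skel.induct)
  case (skel_0 b \<phi>)
  show ?case by (intro provable_weaken provable_verum)
next
  case (skel_Neg b s \<phi>' \<phi>)
  then show ?case using provable_neg_mono by simp
qed (auto intro: provable_weaken provable_conn_mono provable_hyp)

lemma skel_fv: "skel enc b s \<phi>' \<phi> \<Longrightarrow> fv \<phi>' \<subseteq> fv \<phi>"
  by (induction rule: skel.induct) auto

text \<open>The constant 5 is what a binary node adds to its children: three pairs, the tag and the
  end of the list. A coded variable also has 5 symbols, and a marker has one.\<close>

lemma skel_size: "skel enc b s \<phi>' \<phi> \<Longrightarrow> ssize s \<le> 5 * fsize \<phi>"
proof (induction rule: skel.induct)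
  case (skel_0 b \<phi>)
  show ?case using fsize_pos[of \<phi>] by simp
next
  case (skel_1 b \<phi>)
  show ?case using fsize_pos[of \<phi>] by simp
qed (auto simp: node_def)

lemma represents_verum:
  "represents true_code (verum True)" "represents false_code (verum False)"
  by (auto simp: true_code_def false_code_def verum_def simp del: Upair_inject
      intro!: represents.intros)

lemma size_verum_code: "ssize true_code = 15" "ssize false_code = 15"
  by (simp_all add: true_code_def false_code_def node_def)

lemma expand_leaf:
  assumes "k \<notin> {3, 4, 5}"
  shows "\<exists>n. call interp 3 [node k ss, sbool b] = Some (node k ss, n) \<and> n \<le> 30"
  using assms by (simp add: call_interp(4) expand_body_def run_simps node_def)

text \<open>The bounds refer to the original formula \<open>\<phi>\<close>. A marker may replace a
  formula of size 1 and is written out with 15 symbols, whence a factor such as 20.\<close>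

lemma expand_skel:
  "skel enc b s \<phi>' \<phi> \<Longrightarrow> \<exists>u n. call interp 3 [s, sbool b] = Some (u, n) \<and>
     represents u \<phi>' \<and> n \<le> 100 * fsize \<phi> \<and> ssize u \<le> 20 * fsize \<phi>"
proof (induction rule: skel.induct)
  case (skel_0 b \<phi>)
  show ?case using fsize_pos[of \<phi>] represents_verum size_verum_code
    by (cases b) (simp_all add: call_interp(4) expand_body_def run_simps sbool_def)
next
  case (skel_1 b \<phi>)
  show ?case using fsize_pos[of \<phi>] represents_verum size_verum_code
    by (cases b) (simp_all add: call_interp(4) expand_body_def run_simps sbool_def)
next
  case (skel_Var b x)
  have "represents (node 0 [Atom x]) (Var x)" by (rule represents.intros)
  with expand_leaf[of 0 "[Atom x]" b] show ?case by (auto simp: node_def)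
next
  case (skel_Zero b)
  have "represents (node 1 []) Zero" by (rule represents.intros)
  with expand_leaf[of 1 "[]" b] show ?case by (auto simp: node_def)
next
  case (skel_One b)
  have "represents (node 2 []) One" by (rule represents.intros)
  with expand_leaf[of 2 "[]" b] show ?case by (auto simp: node_def)
next
  case (skel_conn c \<phi> \<psi> b s \<phi>' t \<psi>')
  then obtain u n v m where *: "call interp 3 [s, sbool b] = Some (u, n)" "represents u \<phi>'"
    "n \<le> 100 * fsize \<phi>" "ssize u \<le> 20 * fsize \<phi>"
    "call interp 3 [t, sbool b] = Some (v, m)" "represents v \<psi>'"
    "m \<le> 100 * fsize \<psi>" "ssize v \<le> 20 * fsize \<psi>"
    by blast
  then have "represents (node (ctag c) [u, v]) (conn c \<phi>' \<psi>')"
    by (simp add: represents_conn)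
  then have "\<exists>n. call interp 3 [node (ctag c) [s, t], sbool b] =
      Some (node (ctag c) [u, v], n) \<and> n \<le> 100 * fsize (conn c \<phi> \<psi>)"
    using * by (cases c)
      (simp_all add: ctag_def call_interp(4)[of "[SCons x y, q]" for x y q]
        expand_body_def run_simps node_def)
  moreover have "ssize (node (ctag c) [u, v]) \<le> 20 * fsize (conn c \<phi> \<psi>)"
    using * by (simp add: node_def)
  ultimately show ?case using \<open>represents (node _ _) _\<close> by blast
next
  case (skel_Neg b s \<phi>' \<phi>)
  then obtain u n where *: "call interp 3 [s, sbool (\<not> b)] = Some (u, n)" "represents u \<phi>'"
    "n \<le> 100 * fsize \<phi>" "ssize u \<le> 20 * fsize \<phi>"
    by blast
  from * have "\<exists>n. call interp 3 [node 5 [s], sbool b] = Some (node 5 [u], n) \<and>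
      n \<le> 100 * fsize (Neg \<phi>)"
    by (cases b)
      (simp_all add: call_interp(4)[of "[SCons x y, q]" for x y q]
        expand_body_def run_simps node_def sbool_def)
  moreover have "ssize (node 5 [u]) \<le> 20 * fsize (Neg \<phi>)"
    using * by (simp add: node_def)
  moreover have "represents (node 5 [u]) (Neg \<phi>')"
    using * by (auto intro: represents.intros)
  ultimately show ?case by blast
qed


section \<open>Correctness of the program\<close>

text \<open>Because sequents are sets, a context could be empty or coincide with the principal
  formula. Two distinct members exclude both, which is why the program first tests whether
  \<open>\<Gamma>\<close> and \<open>\<Delta>\<close> are the same.\<close>

lemma options_two:
  assumes "set_option \<Theta> \<union> set_option \<Xi> = {\<chi>, \<theta>}" "\<chi> \<noteq> \<theta>"
  shows "\<Theta> = Some \<chi> \<and> \<Xi> = Some \<theta> \<or> \<Theta> = Some \<theta> \<and> \<Xi> = Some \<chi>"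
  using assms by (cases \<Theta>; cases \<Xi>) (auto simp: doubleton_eq_iff singleton_insert_inj_eq')

lemma contextE:
  assumes "S = set_option \<Theta> \<union> {\<pi>}" "S = {\<chi>, \<theta>}" "\<chi> \<noteq> \<theta>"
  obtains \<Xi> where "\<Theta> = Some \<Xi>" "\<Xi> \<in> S" "\<Xi> = \<chi> \<and> \<theta> = \<pi> \<or> \<Xi> = \<theta> \<and> \<chi> = \<pi>"
proof -
  have "set_option \<Theta> \<union> set_option (Some \<pi>) = {\<chi>, \<theta>}" using assms(1,2) by simp
  from options_two[OF this assms(3)] show ?thesis using that assms(2) by auto
qed

lemma dsize_concl: "Suc (seq_size (concl d)) \<le> dsize d"
  by (cases d) simp_all

lemma seq_size_two: "\<chi> \<noteq> \<theta> \<Longrightarrow> seq_size {\<chi>, \<theta>} = fsize (form_of \<chi>) + fsize (form_of \<theta>)"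
  by (simp add: seq_size_def)

locale coded =
  fixes enc :: "form \<Rightarrow> sexp"
  assumes coding: "coding enc"
begin

lemma enc_inj [simp]: "enc \<phi> = enc \<psi> \<longleftrightarrow> \<phi> = \<psi>"
  using coding_represents[OF coding] represents_unique by metis

lemma enc_conn:
  "enc (conn c \<phi> \<psi>) = node (ctag c) [enc \<phi>, enc \<psi>] \<or>
   enc (conn c \<phi> \<psi>) = node (ctag c) [enc \<psi>, enc \<phi>]"
  using coding unfolding coding_def conn_def ctag_def by auto

lemma enc_aform_ann: "enc_aform enc (ann b \<phi>) = node (if b then 1 else 0) [enc \<phi>]"
  by (simp add: ann_def)

lemma enc_aform_inj [simp]: "enc_aform enc \<chi> = enc_aform enc \<theta> \<longleftrightarrow> \<chi> = \<theta>"
  by (cases \<chi>; cases \<theta>) auto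

lemma skel_conn_refl:
  assumes "\<And>b. skel enc b (enc \<phi>) \<phi> \<phi>" "\<And>b. skel enc b (enc \<psi>) \<psi> \<psi>"
  shows "skel enc b (enc (conn c \<phi> \<psi>)) (conn c \<phi> \<psi>) (conn c \<phi> \<psi>)"
  using enc_conn[of c \<phi> \<psi>] skel_conn[of enc c \<phi> \<psi> b] skel_conn[of enc c \<psi> \<phi> b] assms
  by (metis conn_commute)

lemma skel_refl: "skel enc b (enc \<phi>) \<phi> \<phi>"
proof (induction \<phi> arbitrary: b)
  case (AndU p)
  then show ?case using skel_conn_refl[of _ _ b False] by (cases p) auto
next
  case (OrU p)
  then show ?case using skel_conn_refl[of _ _ b True] by (cases p) auto
qed (use coding in \<open>auto simp: coding_def simp del: One_nat_def intro: skel.intros\<close>)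

lemma enc_size: "ssize (enc \<phi>) \<le> 5 * fsize \<phi>"
  using skel_refl skel_size by blast

text \<open>The formula \<open>conn c \<phi> \<psi>\<close> does not tell which child of the node
  belongs to which component. The layout of its code does; this is the purpose of the equation on
  \<open>enc\<close> in the rule \<open>skel_conn\<close>.\<close>

lemma skel_conn_cases:
  assumes "skel enc b u \<chi> (conn c \<phi> \<psi>)"
    and "enc (conn c \<phi> \<psi>) = node (ctag c) [enc \<phi>, enc \<psi>]"
  obtains (marker) a where "u = Atom a"
  | (conn) s t \<phi>' \<psi>' where "u = node (ctag c) [s, t]" "\<chi> = conn c \<phi>' \<psi>'"
      "skel enc b s \<phi>' \<phi>" "skel enc b t \<psi>' \<psi>"
  using assms(1)
proof (cases rule: skel.cases)
  case (skel_conn c0 \<phi>0 \<psi>0 s \<phi>' t \<psi>')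
  from skel_conn(3) have "c0 = c" by (auto simp: conn_def split: if_splits)
  with skel_conn(3,4) assms(2) have "\<phi>0 = \<phi>" "\<psi>0 = \<psi>" by auto
  with skel_conn \<open>c0 = c\<close> show ?thesis using that(2) by blast
qed (auto simp: conn_def split: if_splits intro: that(1))

lemma skel_Neg_cases:
  assumes "skel enc b u \<chi> (Neg \<phi>)"
  obtains (marker) a where "u = Atom a"
  | (Neg) s \<phi>' where "u = node 5 [s]" "\<chi> = Neg \<phi>'" "skel enc (\<not> b) s \<phi>' \<phi>"
  using assms
proof (cases rule: skel.cases)
  case (skel_Neg s \<phi>')
  then show ?thesis using that(2) by blast
qed (auto simp: conn_def split: if_splits intro: that(1))

lemma skel_Atom_cases:
  assumes "skel enc b (Atom a) \<psi> \<phi>"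
  shows "a = 0 \<and> \<psi> = verum (\<not> b) \<or> a = 1 \<and> \<psi> = verum b \<and> provable {ann b \<phi>}"
  using assms by (cases rule: skel.cases) simp_all

section \<open>Joining two skeletons of one formula\<close>

lemma join_Atom:
  assumes "skel enc b s \<phi>' \<phi>" "skel enc b (Atom a) \<psi>' \<phi>"
  shows "join s (Atom a) = s \<and> a = 0 \<and> \<psi>' = verum (\<not> b) \<or>
    join s (Atom a) = Atom 1 \<and> a = 1 \<and> \<psi>' = verum b"
proof (cases s)
  case (Atom k)
  with skel_Atom_cases[of b k \<phi>' \<phi>] skel_Atom_cases[OF assms(2)] assms(1) show ?thesis by auto
next
  case (SCons s1 s2)
  with skel_Atom_cases[OF assms(2)] show ?thesis by auto
qed

lemma join_node2: "join (node (ctag c) [s, t]) (node (ctag c) [s', t']) =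
    node (ctag c) [join s s', join t t']"
  by (simp add: node_def ctag_def)

lemma skel_leaf_cases:
  assumes "skel enc b t \<psi>' \<phi>" "\<phi> \<in> {Zero, One} \<or> (\<exists>x. \<phi> = Var x)" "\<nexists>a. t = Atom a"
  shows "t = enc \<phi> \<and> \<psi>' = \<phi>"
  using assms coding
  by (cases rule: skel.cases) (auto simp: coding_def conn_def split: if_splits)

lemma join_leaf:
  assumes "\<phi> \<in> {Zero, One} \<or> (\<exists>x. \<phi> = Var x)"
  shows "join (enc \<phi>) (enc \<phi>) = enc \<phi>"
  using assms coding by (auto simp: coding_def node_def)

lemma skel_join_Atom:
  assumes s: "skel enc b s \<phi>' \<phi>" and t: "skel enc b (Atom a) \<psi>' \<phi>"
  shows "\<exists>\<chi>. skel enc b (join s (Atom a)) \<chi> \<phi> \<and> fv \<chi> \<subseteq> fv \<phi>' \<union> fv \<psi>' \<and>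
     provable {ann (\<not> b) \<phi>', ann b \<chi>} \<and> provable {ann (\<not> b) \<psi>', ann b \<chi>}"
  using join_Atom[OF s t]
proof (elim disjE conjE)
  assume "join s (Atom a) = s" "\<psi>' = verum (\<not> b)"
  then show ?thesis using s provable_verum[of "\<not> b"]
    by (intro exI[of _ \<phi>']) (auto intro: provable_hyp provable_weaken)
next
  assume "join s (Atom a) = Atom 1" "a = 1" "\<psi>' = verum b"
  then show ?thesis using t provable_verum[of b]
    by (intro exI[of _ "verum b"]) (auto intro: provable_weaken)
qed

lemma skel_join_leaf:
  assumes "\<phi> \<in> {Zero, One} \<or> (\<exists>x. \<phi> = Var x)" "skel enc b t \<psi>' \<phi>" "\<nexists>a. t = Atom a"
  shows "\<exists>\<chi>. skel enc b (join (enc \<phi>) t) \<chi> \<phi> \<and> fv \<chi> \<subseteq> fv \<phi> \<union> fv \<psi>' \<and>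
     provable {ann (\<not> b) \<phi>, ann b \<chi>} \<and> provable {ann (\<not> b) \<psi>', ann b \<chi>}"
proof -
  from skel_leaf_cases[of b t \<psi>' \<phi>] assms have "t = enc \<phi>" "\<psi>' = \<phi>" by auto
  then show ?thesis
    using assms join_leaf[of \<phi>] provable_hyp[of b \<phi>]
    by (intro exI[of _ \<phi>]) auto
qed

text \<open>Skeletons of the same formula follow the layout of the same code, so their pieces meet
  position by position. Marker 0 yields to the other skeleton, marker 1 absorbs it, and the rest is
  monotonicity of the connectives; under negation the flag flips together with the side.\<close>

lemma skel_join:
  "skel enc b s \<phi>' \<phi> \<Longrightarrow> skel enc b t \<psi>' \<phi> \<Longrightarrow>
   \<exists>\<chi>. skel enc b (join s t) \<chi> \<phi> \<and> fv \<chi> \<subseteq> fv \<phi>' \<union> fv \<psi>' \<and>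
     provable {ann (\<not> b) \<phi>', ann b \<chi>} \<and> provable {ann (\<not> b) \<psi>', ann b \<chi>}"
proof (cases "\<exists>a. t = Atom a")
  case True
  then show "skel enc b s \<phi>' \<phi> \<Longrightarrow> skel enc b t \<psi>' \<phi> \<Longrightarrow> ?thesis"
    using skel_join_Atom by blast
next
  case False
  assume "skel enc b s \<phi>' \<phi>" "skel enc b t \<psi>' \<phi>"
  then show ?thesis using False
  proof (induction arbitrary: t \<psi>' rule: skel.induct)
    case (skel_0 b \<phi>)
    then show ?case using provable_verum[of "\<not> b"]
      by (intro exI[of _ \<psi>']) (auto intro: provable_hyp provable_weaken)
  next
    case (skel_1 b \<phi>)
    then show ?case using provable_verum[of b]
      by (intro exI[of _ "verum b"])
        (auto intro: provable_weaken skel.skel_1[simplified])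
  next
    case (skel_Var b x)
    have "enc (Var x) = node 0 [Atom x]" using coding by (simp add: coding_def)
    with skel_join_leaf[of "Var x" b t \<psi>'] skel_Var show ?case by simp
  next
    case (skel_Zero b)
    have "enc Zero = node 1 []" using coding by (simp add: coding_def)
    with skel_join_leaf[of Zero b t \<psi>'] skel_Zero show ?case by simp
  next
    case (skel_One b)
    have "enc One = node 2 []" using coding by (simp add: coding_def)
    with skel_join_leaf[of One b t \<psi>'] skel_One show ?case by simp
  next
    case (skel_conn c \<phi>1 \<phi>2 b s1 \<phi>1' s2 \<phi>2')
    from skel_conn.prems(1) skel_conn.hyps(1)
    obtain t1 t2 \<psi>1' \<psi>2' where t: "t = node (ctag c) [t1, t2]" "\<psi>' = conn c \<psi>1' \<psi>2'"
        "skel enc b t1 \<psi>1' \<phi>1" "skel enc b t2 \<psi>2' \<phi>2"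
      by (cases rule: skel_conn_cases) (use skel_conn.prems(2) in blast)+
    \<comment> \<open>A child of \<open>t\<close> may be a marker although \<open>t\<close> is not
      one. The induction hypothesis excludes this case, and \<open>skel_join_Atom\<close> supplies
      it.\<close>
    from skel_conn.IH(1)[OF t(3)] skel_join_Atom[OF skel_conn.hyps(2)] t(3)
    obtain \<chi>1 where \<chi>1: "skel enc b (join s1 t1) \<chi>1 \<phi>1" "fv \<chi>1 \<subseteq> fv \<phi>1' \<union> fv \<psi>1'"
        "provable {ann (\<not> b) \<phi>1', ann b \<chi>1}" "provable {ann (\<not> b) \<psi>1', ann b \<chi>1}"
      by blast
    from skel_conn.IH(2)[OF t(4)] skel_join_Atom[OF skel_conn.hyps(3)] t(4)
    obtain \<chi>2 where \<chi>2: "skel enc b (join s2 t2) \<chi>2 \<phi>2" "fv \<chi>2 \<subseteq> fv \<phi>2' \<union> fv \<psi>2'"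
        "provable {ann (\<not> b) \<phi>2', ann b \<chi>2}" "provable {ann (\<not> b) \<psi>2', ann b \<chi>2}"
      by blast
    have "skel enc b (node (ctag c) [join s1 t1, join s2 t2]) (conn c \<chi>1 \<chi>2) (conn c \<phi>1 \<phi>2)"
      using skel_conn.hyps(1) \<chi>1(1) \<chi>2(1) by (rule skel.skel_conn)
    with \<chi>1 \<chi>2 show ?case
      by (intro exI[of _ "conn c \<chi>1 \<chi>2"]) (auto simp: t(1,2) join_node2 intro: provable_conn_mono)
  next
    case (skel_Neg b s \<phi>' \<phi>)
    from skel_Neg.prems(1) obtain t1 \<psi>1' where t: "t = node 5 [t1]" "\<psi>' = Neg \<psi>1'"
        "skel enc (\<not> b) t1 \<psi>1' \<phi>"
      by (cases rule: skel_Neg_cases) (use skel_Neg.prems(2) in blast)+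
    from skel_Neg.IH[OF t(3)] skel_join_Atom[OF skel_Neg.hyps(1)] t(3)
    obtain \<chi> where \<chi>: "skel enc (\<not> b) (join s t1) \<chi> \<phi>" "fv \<chi> \<subseteq> fv \<phi>' \<union> fv \<psi>1'"
        "provable {ann b \<phi>', ann (\<not> b) \<chi>}" "provable {ann b \<psi>1', ann (\<not> b) \<chi>}"
      by (simp only: not_not) blast
    have "join (node 5 [s]) (node 5 [t1]) = node 5 [join s t1]" by (simp add: node_def)
    with skel.skel_Neg[OF \<chi>(1)] \<chi> show ?case
      by (intro exI[of _ "Neg \<chi>"]) (auto simp: t(1,2) intro: provable_neg_mono)
  qed
qed

text \<open>The conditional reproduces the program's test for the position of \<open>\<phi>\<close>.
  If both components coincide, the two layouts are equal and the test does no harm.\<close>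

lemma skel_conn_join:
  assumes "skel enc b r \<phi>' \<phi>" "skel enc b r' \<psi>' \<psi>"
    and "enc (conn c \<phi> \<psi>) = node (ctag c) [x, y]"
  shows "skel enc b (if enc \<phi> = x then node (ctag c) [r, r'] else node (ctag c) [r', r])
    (conn c \<phi>' \<psi>') (conn c \<phi> \<psi>)"
proof (cases "enc \<phi> = x")
  case True
  with enc_conn[of c \<phi> \<psi>] assms(3) have "enc (conn c \<phi> \<psi>) = node (ctag c) [enc \<phi>, enc \<psi>]"
    by auto
  from skel_conn[where enc = enc, OF this assms(1,2)] True show ?thesis by simp
next
  case False
  with enc_conn[of c \<phi> \<psi>] assms(3) have "enc (conn c \<psi> \<phi>) = node (ctag c) [enc \<psi>, enc \<phi>]"
    by (auto simp: conn_commute[of c \<psi>])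
  from skel_conn[where enc = enc, OF this assms(2,1)] False show ?thesis
    by (simp add: conn_commute[of c \<psi>] conn_commute[of c \<psi>'])
qed

lemma skel_conn_split:
  assumes "skel enc b (SCons u v) \<chi> (conn c \<phi> \<psi>)"
  obtains x y s t \<phi>' \<psi>' where "enc (conn c \<phi> \<psi>) = node (ctag c) [x, y]"
    "SCons u v = node (ctag c) [s, t]" "\<chi> = conn c \<phi>' \<psi>'"
    "skel enc b (if enc \<phi> = x then s else t) \<phi>' \<phi>" "skel enc b (if enc \<phi> = x then t else s) \<psi>' \<psi>"
proof (cases "enc (conn c \<phi> \<psi>) = node (ctag c) [enc \<phi>, enc \<psi>]")
  case True
  from assms True show ?thesis
    by (cases rule: skel_conn_cases) (use that True in auto)
next
  case False
  with enc_conn[of c \<phi> \<psi>] have *: "enc (conn c \<psi> \<phi>) = node (ctag c) [enc \<psi>, enc \<phi>]"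
    and "\<phi> \<noteq> \<psi>"
    by (auto simp: conn_commute[of c \<psi>])
  have "skel enc b (SCons u v) \<chi> (conn c \<psi> \<phi>)"
    using assms by (simp add: conn_commute[of c \<psi>])
  from this * show ?thesis
  proof (cases rule: skel_conn_cases)
    case (conn s t \<psi>' \<phi>')
    then show ?thesis
      using that[of "enc \<psi>" "enc \<phi>" s t \<phi>' \<psi>'] * \<open>\<phi> \<noteq> \<psi>\<close>
      by (simp add: conn_commute[of c \<psi>] conn_commute[of c \<psi>'])
  qed simp
qed

section \<open>Flow of a skeleton through a proof: invariant and cost\<close>

lemma enc_aform_size: "ssize (enc_aform enc \<chi>) \<le> 5 * fsize (form_of \<chi>) + 4"
  using enc_size[of "form_of \<chi>"] by (cases \<chi>) (simp_all add: node_def)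

text \<open>The source formula stands on side \<open>\<not> a\<close> while its skeleton carries the
  flag \<open>a\<close>: for \<open>a = b = True\<close> a proof of \<gamma> \<le> \<delta> yields
  \<gamma>' \<le> \<delta>'. With this convention the target of one premise of a cut has the same
  flag as the source of the other.\<close>

definition outcome ::
  "nat \<Rightarrow> sexp list \<Rightarrow> nat \<Rightarrow> bool \<Rightarrow> form \<Rightarrow> bool \<Rightarrow> form \<Rightarrow> bool" where
  "outcome k vs B a \<gamma>' b \<delta> \<longleftrightarrow>
     (\<exists>r \<delta>' n. call interp k vs = Some (r, n) \<and> n \<le> B \<and> skel enc b r \<delta>' \<delta> \<and>
       fv \<delta>' \<subseteq> fv \<gamma>' \<and> provable {ann (\<not> a) \<gamma>', ann b \<delta>'})"

abbreviation flow_outcome ::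
  "deriv \<Rightarrow> bool \<Rightarrow> form \<Rightarrow> sexp \<Rightarrow> form \<Rightarrow> bool \<Rightarrow> form \<Rightarrow> bool" where
  "flow_outcome d a \<gamma> s \<gamma>' b \<delta> \<equiv>
     outcome 4 [enc_deriv enc d, enc_aform enc (ann (\<not> a) \<gamma>), s, enc_aform enc (ann b \<delta>)]
       (400 * dsize d) a \<gamma>' b \<delta>"

lemma skel_refuted:
  assumes "skel enc a s \<gamma>' \<gamma>" "provable {ann (\<not> a) \<gamma>}"
  shows "provable {ann (\<not> a) \<gamma>', \<chi>}"
  using provable_cut1[of "\<not> a" \<gamma> "ann (\<not> a) \<gamma>'"] assms(2) skel_provable[OF assms(1)]
  by (intro provable_weaken) (simp add: insert_commute)

text \<open>A skeleton of a refuted source is itself refuted, by a cut against the source. Weakening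
  then adds any target, in particular falsity, which has no variables.\<close>

lemma outcome_0:
  assumes "\<exists>n. call interp k vs = Some (Atom 0, n) \<and> n \<le> B"
    and "skel enc a s \<gamma>' \<gamma>" "provable {ann (\<not> a) \<gamma>}"
  shows "outcome k vs B a \<gamma>' b \<delta>"
proof -
  have "skel enc b (Atom 0) (verum (\<not> b)) \<delta>" by (rule skel_0)
  then show ?thesis
    unfolding outcome_def using assms(1) skel_refuted[OF assms(2,3)] fv_verum by blast
qed

lemma outcome_1:
  assumes "\<exists>n. call interp k vs = Some (Atom 1, n) \<and> n \<le> B" "provable {ann b \<delta>}"
  shows "outcome k vs B a \<gamma>' b \<delta>"
  unfolding outcome_def
  using assms(1) skel_1[OF assms(2), of enc] provable_weaken(2)[OF provable_verum[of b]] fv_verum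
  by blast

text \<open>Two cases are settled without looking at the last inference. A marker passes unchanged:
  0 implies everything, and 1 certifies that the source is valid, so a cut against the whole proof
  makes the target valid. If source and target coincide, the sequent is a singleton and the source
  is refuted.\<close>

lemma flow_outcomeI:
  assumes d: "is_proof d" "concl d = {ann (\<not> a) \<gamma>, ann b \<delta>}" and s: "skel enc a s \<gamma>' \<gamma>"
    and step: "\<And>s1 s2. s = SCons s1 s2 \<Longrightarrow> ann (\<not> a) \<gamma> \<noteq> ann b \<delta> \<Longrightarrow>
      flow_outcome d a \<gamma> s \<gamma>' b \<delta>"
  shows "flow_outcome d a \<gamma> s \<gamma>' b \<delta>"
proof (cases s)
  case (Atom k)
  let ?vs = "[enc_deriv enc d, enc_aform enc (ann (\<not> a) \<gamma>), s, enc_aform enc (ann b \<delta>)]"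
  have call: "\<exists>n. call interp 4 ?vs = Some (Atom k, n) \<and> n \<le> 400 * dsize d"
    using call_flow_marker[of "enc_deriv enc d" _ k] dsize_concl[of d] Atom
    by (fastforce intro: le_trans)
  from skel_Atom_cases[OF s[unfolded Atom]] show ?thesis
  proof (elim disjE conjE)
    assume "k = 0" and \<gamma>': "\<gamma>' = verum (\<not> a)"
    have "skel enc b (Atom 0) (verum (\<not> b)) \<delta>" by (rule skel_0)
    moreover have "provable {ann (\<not> a) \<gamma>', ann b (verum (\<not> b))}"
      unfolding \<gamma>' by (intro provable_weaken provable_verum)
    ultimately show ?thesis
      unfolding outcome_def using call \<open>k = 0\<close> fv_verum by blast
  next
    assume "k = 1" "provable {ann a \<gamma>}"
    have "provable {ann b \<delta>}"
      using provable_cut1[OF \<open>provable {ann a \<gamma>}\<close>] provableI[OF d] by blast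
    with call \<open>k = 1\<close> show ?thesis by (intro outcome_1) auto
  qed
next
  case (SCons s1 s2)
  show ?thesis
  proof (cases "ann (\<not> a) \<gamma> = ann b \<delta>")
    case True
    have "provable {ann (\<not> a) \<gamma>}" using provableI[OF d] True by simp
    moreover have "seq_size (concl d) = fsize \<gamma>" using d(2) True by (simp add: seq_size_def)
    then have "20 * ssize (enc_aform enc (ann b \<delta>)) + 20 \<le> 400 * dsize d"
      using dsize_concl[of d] enc_aform_size[of "ann b \<delta>"] True by simp
    then have "\<exists>n. call interp 4 [enc_deriv enc d, enc_aform enc (ann (\<not> a) \<gamma>), s,
        enc_aform enc (ann b \<delta>)] = Some (Atom 0, n) \<and> n \<le> 400 * dsize d"
      unfolding True SCons using call_flow_same order_trans by meson
    ultimately show ?thesis using s by (intro outcome_0)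
  next
    case False
    with SCons show ?thesis by (rule step)
  qed
qed

text \<open>The two equality tests cost 20 per symbol of code, and the code of an annotated formula
  has at most 5 symbols per unit of size plus 4. As \<open>\<Theta>\<close> is one of the two
  formulas, this gives the slack of 200 per unit plus 200. The rules add at most 100 per unit plus
  200, so 400 suffices; the unit for the rule name in \<open>dsize\<close> pays for the
  constants.\<close>

lemma flow_outcome_step:
  assumes "ann (\<not> a) \<gamma> \<noteq> ann b \<delta>" "concl d = {ann (\<not> a) \<gamma>, ann b \<delta>}" "s = SCons s1 s2"
    and "enc_deriv enc d = node k (enc_opt enc (Some \<Theta>) # ds)" "k \<noteq> 0" "\<Theta> \<in> concl d"
    and "outcome 5 [enc_deriv enc d, enc_aform enc (ann (\<not> a) \<gamma>), s, enc_aform enc (ann b \<delta>),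
      sbool (\<Theta> = ann (\<not> a) \<gamma>)] B a \<gamma>' b \<delta>"
    and "B + 200 * (fsize \<gamma> + fsize \<delta>) + 200 \<le> 400 * dsize d"
  shows "flow_outcome d a \<gamma> s \<gamma>' b \<delta>"
proof -
  have "fsize (form_of \<Theta>) \<le> fsize \<gamma> + fsize \<delta>" using assms(2,6) by auto
  with enc_aform_size[of \<Theta>] enc_aform_size[of "ann (\<not> a) \<gamma>"] assms(8)
  have le: "B + 20 * ssize (enc_aform enc (ann (\<not> a) \<gamma>)) + 20 * ssize (enc_aform enc \<Theta>) + 40
      \<le> 400 * dsize d"
    by simp
  from assms(7) obtain r \<delta>' n where r: "call interp 5 [enc_deriv enc d,
      enc_aform enc (ann (\<not> a) \<gamma>), s, enc_aform enc (ann b \<delta>), sbool (\<Theta> = ann (\<not> a) \<gamma>)] = Some (r, n)"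
    "n \<le> B" "skel enc b r \<delta>' \<delta>" "fv \<delta>' \<subseteq> fv \<gamma>'" "provable {ann (\<not> a) \<gamma>', ann b \<delta>'}"
    unfolding outcome_def by blast
  have "\<exists>n. call interp 4 [enc_deriv enc d, enc_aform enc (ann (\<not> a) \<gamma>), s,
      enc_aform enc (ann b \<delta>)] = Some (r, n) \<and> n \<le> 400 * dsize d"
    using call_flow_dispatch[of "enc_aform enc (ann (\<not> a) \<gamma>)" "enc_aform enc (ann b \<delta>)" k
        "enc_aform enc \<Theta>" ds s1 s2 r n] r(1,2) le assms(1,3,4,5)
    by (fastforce simp del: ann_simps)
  with r show ?thesis unfolding outcome_def by blast
qed

lemma outcomeE:
  assumes "outcome k vs B a \<gamma>' b \<delta>"
  obtains r \<delta>' n where "call interp k vs = Some (r, n)" "n \<le> B" "skel enc b r \<delta>' \<delta>"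
    "fv \<delta>' \<subseteq> fv \<gamma>'" "provable {ann (\<not> a) \<gamma>', ann b \<delta>'}"
  using assms unfolding outcome_def by blast

lemma outcomeI:
  assumes "\<exists>n. call interp k vs = Some (r, n) \<and> n \<le> B" "skel enc b r \<delta>' \<delta>"
    "fv \<delta>' \<subseteq> fv \<gamma>'" "provable {ann (\<not> a) \<gamma>', ann b \<delta>'}"
  shows "outcome k vs B a \<gamma>' b \<delta>"
  using assms unfolding outcome_def by blast

text \<open>Here \<open>p\<close> is the side of the principal formula. In a target, falsity for the
  missing component brings in no variables. In a source, only the active component of the skeleton
  enters the premise, and the one-premise rule puts the other one back afterwards.\<close>

lemma flow_unary:
  assumes IH: "\<And>a \<gamma> s \<gamma>' b \<delta>. concl d = {ann (\<not> a) \<gamma>, ann b \<delta>} \<Longrightarrow> skel enc a s \<gamma>' \<gamma> \<Longrightarrow>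
      flow_outcome d a \<gamma> s \<gamma>' b \<delta>"
    and d: "concl d = set_option \<Theta> \<union> {ann p \<phi>}"
    and e: "concl e = set_option \<Theta> \<union> {ann p (conn p \<phi> \<psi>)}"
      "enc_deriv enc e = node (if p then 6 else 3)
        [enc_opt enc \<Theta>, enc \<phi>, enc \<psi>, enc_deriv enc d]"
      "dsize e = Suc (seq_size (concl e) + dsize d)"
    and goal: "concl e = {ann (\<not> a) \<gamma>, ann b \<delta>}" "ann (\<not> a) \<gamma> \<noteq> ann b \<delta>"
      "skel enc a s \<gamma>' \<gamma>" "s = SCons s1 s2"
  shows "flow_outcome e a \<gamma> s \<gamma>' b \<delta>"
proof -
  let ?k = "if p then 6 else 3 :: nat"
  have size: "dsize e = Suc (fsize \<gamma> + fsize \<delta> + dsize d)"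
    using e(3) goal(1) seq_size_two[OF goal(2)] by simp
  have k: "?k \<in> {3, 6}" "?k \<noteq> 0" by simp_all
  have enc_ann: "enc_aform enc (ann p \<chi>) = node (if p then 1 else 0) [enc \<chi>]" for \<chi>
    by (rule enc_aform_ann)
  obtain \<Xi> where \<Xi>: "\<Theta> = Some \<Xi>" "\<Xi> \<in> concl e"
    "\<Xi> = ann (\<not> a) \<gamma> \<and> ann b \<delta> = ann p (conn p \<phi> \<psi>) \<or>
     \<Xi> = ann b \<delta> \<and> ann (\<not> a) \<gamma> = ann p (conn p \<phi> \<psi>)"
    using e(1) goal(1,2) by (rule contextE)
  have "outcome 5 [enc_deriv enc e, enc_aform enc (ann (\<not> a) \<gamma>), s, enc_aform enc (ann b \<delta>),
      sbool (\<Xi> = ann (\<not> a) \<gamma>)] (400 * dsize d + 100 * (fsize \<gamma> + fsize \<delta>) + 200) a \<gamma>' b \<delta>"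
    using \<Xi>(3)
  proof (elim disjE conjE)
    assume *: "\<Xi> = ann (\<not> a) \<gamma>" "ann b \<delta> = ann p (conn p \<phi> \<psi>)"
    then have "concl d = {ann (\<not> a) \<gamma>, ann p \<phi>}" using d \<Xi>(1) by auto
    from IH[OF this goal(3)] obtain r \<phi>' n where r:
      "call interp 4 [enc_deriv enc d, enc_aform enc (ann (\<not> a) \<gamma>), s, enc_aform enc (ann p \<phi>)]
        = Some (r, n)" "n \<le> 400 * dsize d"
      "skel enc p r \<phi>' \<phi>" "fv \<phi>' \<subseteq> fv \<gamma>'" "provable {ann (\<not> a) \<gamma>', ann p \<phi>'}"
      by (rule outcomeE)
    from * have b: "b = p" "\<delta> = conn p \<phi> \<psi>" by auto
    obtain x y where xy: "enc (conn p \<phi> \<psi>) = node (ctag p) [x, y]"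
      using enc_conn[of p \<phi> \<psi>] by auto
    show ?thesis
    proof (rule outcomeI)
      show "\<exists>n. call interp 5 [enc_deriv enc e, enc_aform enc (ann (\<not> a) \<gamma>), s,
          enc_aform enc (ann b \<delta>), sbool (\<Xi> = ann (\<not> a) \<gamma>)] =
          Some (if enc \<phi> = x then node (ctag p) [r, Atom 0] else node (ctag p) [Atom 0, r], n) \<and>
          n \<le> 400 * dsize d + 100 * (fsize \<gamma> + fsize \<delta>) + 200"
        using call_unary_output[OF k(1) r(1)[unfolded enc_ann],
            of "enc_opt enc \<Theta>" "enc \<psi>" "ctag p" x y] r(2) enc_size[of \<phi>]
        unfolding e(2) b enc_ann xy \<open>\<Xi> = _\<close> conn_simps
        by fastforce
      show "skel enc b (if enc \<phi> = x then node (ctag p) [r, Atom 0] else node (ctag p) [Atom 0, r])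
          (conn p \<phi>' (verum (\<not> p))) \<delta>"
        unfolding b using r(3) skel_0 xy by (rule skel_conn_join)
      show "fv (conn p \<phi>' (verum (\<not> p))) \<subseteq> fv \<gamma>'" using r(4) by simp
      show "provable {ann (\<not> a) \<gamma>', ann b (conn p \<phi>' (verum (\<not> p)))}"
        unfolding b using r(5) by (rule provable_unary)
    qed
  next
    assume *: "\<Xi> = ann b \<delta>" "ann (\<not> a) \<gamma> = ann p (conn p \<phi> \<psi>)"
    then have "concl d = {ann p \<phi>, ann b \<delta>}" using d \<Xi>(1) by auto
    then have cd: "concl d = {ann (\<not> (\<not> p)) \<phi>, ann b \<delta>}" by simp
    from * have a: "a = (\<not> p)" "\<gamma> = conn p \<phi> \<psi>" by auto
    from goal(3) obtain x y t u \<phi>' \<psi>' where xy: "enc (conn p \<phi> \<psi>) = node (ctag p) [x, y]"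
      "s = node (ctag p) [t, u]" "\<gamma>' = conn p \<phi>' \<psi>'"
      "skel enc (\<not> p) (if enc \<phi> = x then t else u) \<phi>' \<phi>"
      unfolding goal(4) a by (rule skel_conn_split)
    from IH[OF cd xy(4)] obtain r \<delta>' n where r:
      "call interp 4 [enc_deriv enc d, enc_aform enc (ann p \<phi>), if enc \<phi> = x then t else u,
        enc_aform enc (ann b \<delta>)] = Some (r, n)" "n \<le> 400 * dsize d"
      "skel enc b r \<delta>' \<delta>" "fv \<delta>' \<subseteq> fv \<phi>'" "provable {ann p \<phi>', ann b \<delta>'}"
      unfolding not_not by (rule outcomeE[where a = "\<not> p", unfolded not_not])
    have not: "(\<Xi> = ann (\<not> a) \<gamma>) = False" using *(1) goal(2) by metis
    show ?thesis
    proof (rule outcomeI)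
      show "\<exists>n. call interp 5 [enc_deriv enc e, enc_aform enc (ann (\<not> a) \<gamma>), s,
          enc_aform enc (ann b \<delta>), sbool (\<Xi> = ann (\<not> a) \<gamma>)] = Some (r, n) \<and>
          n \<le> 400 * dsize d + 100 * (fsize \<gamma> + fsize \<delta>) + 200"
        using call_unary_input[OF k(1) r(1)[unfolded enc_ann],
            of "enc_opt enc \<Theta>" "enc \<psi>" "ctag p" y "ctag p"] r(2) enc_size[of \<phi>]
        unfolding e(2) not unfolding a not_not enc_ann xy(1,2) conn_simps
        by fastforce
      show "skel enc b r \<delta>' \<delta>" by fact
      show "fv \<delta>' \<subseteq> fv \<gamma>'" using r(4) xy(3) by auto
      show "provable {ann (\<not> a) \<gamma>', ann b \<delta>'}"
        using provable_unary[of "ann b \<delta>'" p \<phi>' \<psi>'] r(5)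
        unfolding a xy(3) by (simp add: insert_commute)
    qed
  qed
  then show ?thesis
    using flow_outcome_step[OF goal(2,1,4) _ k(2) \<Xi>(2)] e(2) \<Xi>(1) size by simp
qed

lemma flow_binary:
  assumes IH: "\<And>a \<gamma> s \<gamma>' b \<delta>. concl d = {ann (\<not> a) \<gamma>, ann b \<delta>} \<Longrightarrow> skel enc a s \<gamma>' \<gamma> \<Longrightarrow>
      flow_outcome d a \<gamma> s \<gamma>' b \<delta>"
    and IH': "\<And>a \<gamma> s \<gamma>' b \<delta>. concl d' = {ann (\<not> a) \<gamma>, ann b \<delta>} \<Longrightarrow> skel enc a s \<gamma>' \<gamma> \<Longrightarrow>
      flow_outcome d' a \<gamma> s \<gamma>' b \<delta>"
    and d: "concl d = set_option \<Theta> \<union> {ann p \<phi>}"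
    and d': "concl d' = set_option \<Theta> \<union> {ann p \<psi>}"
    and e: "concl e = set_option \<Theta> \<union> {ann p (conn (\<not> p) \<phi> \<psi>)}"
      "enc_deriv enc e = node (if p then 4 else 5)
        [enc_opt enc \<Theta>, enc \<phi>, enc \<psi>, enc_deriv enc d, enc_deriv enc d']"
      "dsize e = Suc (seq_size (concl e) + dsize d + dsize d')"
    and goal: "concl e = {ann (\<not> a) \<gamma>, ann b \<delta>}" "ann (\<not> a) \<gamma> \<noteq> ann b \<delta>"
      "skel enc a s \<gamma>' \<gamma>" "s = SCons s1 s2"
  shows "flow_outcome e a \<gamma> s \<gamma>' b \<delta>"
proof -
  let ?k = "if p then 4 else 5 :: nat"
  let ?B = "400 * dsize d + 400 * dsize d' + 100 * (fsize \<gamma> + fsize \<delta>) + 200"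
  have size: "dsize e = Suc (fsize \<gamma> + fsize \<delta> + dsize d + dsize d')"
    using e(3) goal(1) seq_size_two[OF goal(2)] by simp
  have k: "?k \<in> {4, 5}" "?k \<noteq> 0" by simp_all
  have enc_ann: "enc_aform enc (ann p \<chi>) = node (if p then 1 else 0) [enc \<chi>]" for \<chi>
    by (rule enc_aform_ann)
  obtain \<Xi> where \<Xi>: "\<Theta> = Some \<Xi>" "\<Xi> \<in> concl e"
    "\<Xi> = ann (\<not> a) \<gamma> \<and> ann b \<delta> = ann p (conn (\<not> p) \<phi> \<psi>) \<or>
     \<Xi> = ann b \<delta> \<and> ann (\<not> a) \<gamma> = ann p (conn (\<not> p) \<phi> \<psi>)"
    using e(1) goal(1,2) by (rule contextE)
  have "outcome 5 [enc_deriv enc e, enc_aform enc (ann (\<not> a) \<gamma>), s, enc_aform enc (ann b \<delta>),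
      sbool (\<Xi> = ann (\<not> a) \<gamma>)] ?B a \<gamma>' b \<delta>"
    using \<Xi>(3)
  proof (elim disjE conjE)
    assume *: "\<Xi> = ann (\<not> a) \<gamma>" "ann b \<delta> = ann p (conn (\<not> p) \<phi> \<psi>)"
    then have "concl d = {ann (\<not> a) \<gamma>, ann p \<phi>}" using d \<Xi>(1) by auto
    from IH[OF this goal(3)] obtain r \<phi>' n where r:
      "call interp 4 [enc_deriv enc d, enc_aform enc (ann (\<not> a) \<gamma>), s, enc_aform enc (ann p \<phi>)]
        = Some (r, n)" "n \<le> 400 * dsize d"
      "skel enc p r \<phi>' \<phi>" "fv \<phi>' \<subseteq> fv \<gamma>'" "provable {ann (\<not> a) \<gamma>', ann p \<phi>'}"
      by (rule outcomeE)
    have "concl d' = {ann (\<not> a) \<gamma>, ann p \<psi>}" using * d' \<Xi>(1) by auto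
    from IH'[OF this goal(3)] obtain r' \<psi>' n' where r':
      "call interp 4 [enc_deriv enc d', enc_aform enc (ann (\<not> a) \<gamma>), s, enc_aform enc (ann p \<psi>)]
        = Some (r', n')" "n' \<le> 400 * dsize d'"
      "skel enc p r' \<psi>' \<psi>" "fv \<psi>' \<subseteq> fv \<gamma>'" "provable {ann (\<not> a) \<gamma>', ann p \<psi>'}"
      by (rule outcomeE)
    from * have b: "b = p" "\<delta> = conn (\<not> p) \<phi> \<psi>" by auto
    obtain x y where xy: "enc (conn (\<not> p) \<phi> \<psi>) = node (ctag (\<not> p)) [x, y]"
      using enc_conn[of "\<not> p" \<phi> \<psi>] by auto
    show ?thesis
    proof (rule outcomeI)
      show "\<exists>n. call interp 5 [enc_deriv enc e, enc_aform enc (ann (\<not> a) \<gamma>), s,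
          enc_aform enc (ann b \<delta>), sbool (\<Xi> = ann (\<not> a) \<gamma>)] =
          Some (if enc \<phi> = x then node (ctag (\<not> p)) [r, r'] else node (ctag (\<not> p)) [r', r], n) \<and>
          n \<le> ?B"
        using call_binary_output[OF k(1) r(1)[unfolded enc_ann] r'(1)[unfolded enc_ann],
            of "enc_opt enc \<Theta>" "ctag (\<not> p)" x y] r(2) r'(2) enc_size[of \<phi>]
        unfolding e(2) b enc_ann xy \<open>\<Xi> = _\<close> conn_simps
        by fastforce
      show "skel enc b (if enc \<phi> = x then node (ctag (\<not> p)) [r, r'] else node (ctag (\<not> p)) [r', r])
          (conn (\<not> p) \<phi>' \<psi>') \<delta>"
        unfolding b using r(3) r'(3) xy by (rule skel_conn_join)
      show "fv (conn (\<not> p) \<phi>' \<psi>') \<subseteq> fv \<gamma>'" using r(4) r'(4) by simp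
      show "provable {ann (\<not> a) \<gamma>', ann b (conn (\<not> p) \<phi>' \<psi>')}"
        unfolding b using r(5) r'(5) by (rule provable_binary)
    qed
  next
    assume *: "\<Xi> = ann b \<delta>" "ann (\<not> a) \<gamma> = ann p (conn (\<not> p) \<phi> \<psi>)"
    then have "concl d = {ann p \<phi>, ann b \<delta>}" "concl d' = {ann p \<psi>, ann b \<delta>}"
      using d d' \<Xi>(1) by auto
    then have cd: "concl d = {ann (\<not> (\<not> p)) \<phi>, ann b \<delta>}" "concl d' = {ann (\<not> (\<not> p)) \<psi>, ann b \<delta>}"
      by simp_all
    from * have a: "a = (\<not> p)" "\<gamma> = conn (\<not> p) \<phi> \<psi>" by auto
    from goal(3) obtain x y t u \<phi>' \<psi>' where xy:
      "enc (conn (\<not> p) \<phi> \<psi>) = node (ctag (\<not> p)) [x, y]"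
      "s = node (ctag (\<not> p)) [t, u]" "\<gamma>' = conn (\<not> p) \<phi>' \<psi>'"
      "skel enc (\<not> p) (if enc \<phi> = x then t else u) \<phi>' \<phi>"
      "skel enc (\<not> p) (if enc \<phi> = x then u else t) \<psi>' \<psi>"
      unfolding goal(4) a by (rule skel_conn_split)
    from IH[OF cd(1) xy(4)] obtain r \<delta>' n where r:
      "call interp 4 [enc_deriv enc d, enc_aform enc (ann p \<phi>), if enc \<phi> = x then t else u,
        enc_aform enc (ann b \<delta>)] = Some (r, n)" "n \<le> 400 * dsize d"
      "skel enc b r \<delta>' \<delta>" "fv \<delta>' \<subseteq> fv \<phi>'" "provable {ann p \<phi>', ann b \<delta>'}"
      unfolding not_not by (rule outcomeE[where a = "\<not> p", unfolded not_not])
    from IH'[OF cd(2) xy(5)] obtain r' \<delta>'' n' where r':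
      "call interp 4 [enc_deriv enc d', enc_aform enc (ann p \<psi>), if enc \<phi> = x then u else t,
        enc_aform enc (ann b \<delta>)] = Some (r', n')" "n' \<le> 400 * dsize d'"
      "skel enc b r' \<delta>'' \<delta>" "fv \<delta>'' \<subseteq> fv \<psi>'" "provable {ann p \<psi>', ann b \<delta>''}"
      unfolding not_not by (rule outcomeE[where a = "\<not> p", unfolded not_not])
    \<comment> \<open>The two-premise rule needs one common context, but the premises give two
      skeletons of \<open>\<delta>\<close>. Cuts raise both to their join, which adds no variables
      and keeps the shape of \<open>\<delta>\<close>.\<close>
    from skel_join[OF r(3) r'(3)] obtain \<chi> where \<chi>: "skel enc b (join r r') \<chi> \<delta>"
      "fv \<chi> \<subseteq> fv \<delta>' \<union> fv \<delta>''" "provable {ann (\<not> b) \<delta>', ann b \<chi>}" "provable {ann (\<not> b) \<delta>'', ann b \<chi>}"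
      by blast
    have not: "(\<Xi> = ann (\<not> a) \<gamma>) = False" using *(1) goal(2) by metis
    show ?thesis
    proof (rule outcomeI)
      show "\<exists>n. call interp 5 [enc_deriv enc e, enc_aform enc (ann (\<not> a) \<gamma>), s,
          enc_aform enc (ann b \<delta>), sbool (\<Xi> = ann (\<not> a) \<gamma>)] = Some (join r r', n) \<and> n \<le> ?B"
        using call_binary_input[OF k(1) r(1)[unfolded enc_ann] r'(1)[unfolded enc_ann],
            of "enc_opt enc \<Theta>" "ctag (\<not> p)" y "ctag (\<not> p)"] r(2) r'(2) enc_size[of \<phi>]
          skel_size[OF r(3)]
        unfolding e(2) not unfolding a not_not enc_ann xy(1,2) conn_simps
        by fastforce
      show "skel enc b (join r r') \<chi> \<delta>" by fact
      show "fv \<chi> \<subseteq> fv \<gamma>'" using \<chi>(2) r(4) r'(4) xy(3) by auto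
      have "provable {ann p \<phi>', ann b \<chi>}" "provable {ann p \<psi>', ann b \<chi>}"
        using provable_cut2[OF r(5) \<chi>(3)] provable_cut2[OF r'(5) \<chi>(4)] by auto
      then show "provable {ann (\<not> a) \<gamma>', ann b \<chi>}"
        using provable_binary[of "ann b \<chi>" p \<phi>' \<psi>']
        unfolding a xy(3) by (simp add: insert_commute)
    qed
  qed
  then show ?thesis
    using flow_outcome_step[OF goal(2,1,4) _ k(2) \<Xi>(2)] e(2) \<Xi>(1) size by simp
qed

text \<open>Negation changes the side and the flag together, so the markers keep their reading and
  the same S-expression is reused; only the node for the negation is added or removed.\<close>

lemma flow_neg:
  assumes IH: "\<And>a \<gamma> s \<gamma>' b \<delta>. concl d = {ann (\<not> a) \<gamma>, ann b \<delta>} \<Longrightarrow> skel enc a s \<gamma>' \<gamma> \<Longrightarrow>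
      flow_outcome d a \<gamma> s \<gamma>' b \<delta>"
    and d: "concl d = set_option \<Theta> \<union> {ann p \<phi>}"
    and e: "concl e = set_option \<Theta> \<union> {ann (\<not> p) (Neg \<phi>)}"
      "enc_deriv enc e = node (if p then 7 else 8) [enc_opt enc \<Theta>, enc \<phi>, enc_deriv enc d]"
      "dsize e = Suc (seq_size (concl e) + dsize d)"
    and goal: "concl e = {ann (\<not> a) \<gamma>, ann b \<delta>}" "ann (\<not> a) \<gamma> \<noteq> ann b \<delta>"
      "skel enc a s \<gamma>' \<gamma>" "s = SCons s1 s2"
  shows "flow_outcome e a \<gamma> s \<gamma>' b \<delta>"
proof -
  let ?k = "if p then 7 else 8 :: nat"
  have size: "dsize e = Suc (fsize \<gamma> + fsize \<delta> + dsize d)"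
    using e(3) goal(1) seq_size_two[OF goal(2)] by simp
  have k: "?k \<in> {7, 8}" "?k \<noteq> 0" by simp_all
  have enc_ann: "enc_aform enc (ann p \<chi>) = node (if ?k = 7 then 1 else 0) [enc \<chi>]" for \<chi>
    by (simp add: enc_aform_ann del: One_nat_def)
  obtain \<Xi> where \<Xi>: "\<Theta> = Some \<Xi>" "\<Xi> \<in> concl e"
    "\<Xi> = ann (\<not> a) \<gamma> \<and> ann b \<delta> = ann (\<not> p) (Neg \<phi>) \<or>
     \<Xi> = ann b \<delta> \<and> ann (\<not> a) \<gamma> = ann (\<not> p) (Neg \<phi>)"
    using e(1) goal(1,2) by (rule contextE)
  have "outcome 5 [enc_deriv enc e, enc_aform enc (ann (\<not> a) \<gamma>), s, enc_aform enc (ann b \<delta>),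
      sbool (\<Xi> = ann (\<not> a) \<gamma>)] (400 * dsize d + 200) a \<gamma>' b \<delta>"
    using \<Xi>(3)
  proof (elim disjE conjE)
    assume *: "\<Xi> = ann (\<not> a) \<gamma>" "ann b \<delta> = ann (\<not> p) (Neg \<phi>)"
    then have "concl d = {ann (\<not> a) \<gamma>, ann p \<phi>}" using d \<Xi>(1) by auto
    from IH[OF this goal(3)] obtain r \<phi>' n where r:
      "call interp 4 [enc_deriv enc d, enc_aform enc (ann (\<not> a) \<gamma>), s, enc_aform enc (ann p \<phi>)]
        = Some (r, n)" "n \<le> 400 * dsize d"
      "skel enc p r \<phi>' \<phi>" "fv \<phi>' \<subseteq> fv \<gamma>'" "provable {ann (\<not> a) \<gamma>', ann p \<phi>'}"
      by (rule outcomeE)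
    from * have b: "b = (\<not> p)" "\<delta> = Neg \<phi>" by auto
    show ?thesis
    proof (rule outcomeI)
      show "\<exists>n. call interp 5 [enc_deriv enc e, enc_aform enc (ann (\<not> a) \<gamma>), s,
          enc_aform enc (ann b \<delta>), sbool (\<Xi> = ann (\<not> a) \<gamma>)] = Some (node 5 [r], n) \<and>
          n \<le> 400 * dsize d + 200"
        using call_neg_output[OF k(1) r(1)[unfolded enc_ann],
            of "enc_opt enc \<Theta>" "enc_aform enc (ann b \<delta>)"] r(2)
        unfolding e(2) \<open>\<Xi> = _\<close> by fastforce
      show "skel enc b (node 5 [r]) (Neg \<phi>') \<delta>"
        unfolding b by (rule skel_Neg) (simp add: r(3))
      show "fv (Neg \<phi>') \<subseteq> fv \<gamma>'" using r(4) by simp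
      show "provable {ann (\<not> a) \<gamma>', ann b (Neg \<phi>')}"
        unfolding b using r(5) by (rule provable_neg)
    qed
  next
    assume *: "\<Xi> = ann b \<delta>" "ann (\<not> a) \<gamma> = ann (\<not> p) (Neg \<phi>)"
    then have "concl d = {ann p \<phi>, ann b \<delta>}" using d \<Xi>(1) by auto
    then have cd: "concl d = {ann (\<not> (\<not> p)) \<phi>, ann b \<delta>}" by simp
    from * have a: "a = p" "\<gamma> = Neg \<phi>" by auto
    from goal(3) obtain t \<phi>' where t: "s = node 5 [t]" "\<gamma>' = Neg \<phi>'" "skel enc (\<not> p) t \<phi>' \<phi>"
      unfolding goal(4) a by (cases rule: skel_Neg_cases) auto
    from IH[OF cd t(3)] obtain r \<delta>' n where r:
      "call interp 4 [enc_deriv enc d, enc_aform enc (ann p \<phi>), t, enc_aform enc (ann b \<delta>)]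
        = Some (r, n)" "n \<le> 400 * dsize d"
      "skel enc b r \<delta>' \<delta>" "fv \<delta>' \<subseteq> fv \<phi>'" "provable {ann p \<phi>', ann b \<delta>'}"
      unfolding not_not by (rule outcomeE[where a = "\<not> p", unfolded not_not])
    have not: "(\<Xi> = ann (\<not> a) \<gamma>) = False" using *(1) goal(2) by metis
    show ?thesis
    proof (rule outcomeI)
      show "\<exists>n. call interp 5 [enc_deriv enc e, enc_aform enc (ann (\<not> a) \<gamma>), s,
          enc_aform enc (ann b \<delta>), sbool (\<Xi> = ann (\<not> a) \<gamma>)] = Some (r, n) \<and>
          n \<le> 400 * dsize d + 200"
        using call_neg_input[OF k(1) r(1)[unfolded enc_ann],
            of "enc_opt enc \<Theta>" "enc_aform enc (ann (\<not> a) \<gamma>)" 5] r(2)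
        unfolding e(2) not t(1) by fastforce
      show "skel enc b r \<delta>' \<delta>" by fact
      show "fv \<delta>' \<subseteq> fv \<gamma>'" using r(4) t(2) by auto
      show "provable {ann (\<not> a) \<gamma>', ann b \<delta>'}"
        using provable_neg[of "ann b \<delta>'" p \<phi>'] r(5)
        unfolding a t(2) by (simp add: insert_commute)
    qed
  qed
  then show ?thesis
    using flow_outcome_step[OF goal(2,1,4) _ k(2) \<Xi>(2)] e(2) \<Xi>(1) size by simp
qed

text \<open>The cut formula is absent from the conclusion, so no cost proportional to it can be
  charged here. Its code is merely passed on inside a new node, at constant cost; comparisons with
  it are paid for by the premises, where it occurs.\<close>

lemma flow_cut:
  assumes IH: "\<And>a \<gamma> s \<gamma>' b \<delta>. concl d = {ann (\<not> a) \<gamma>, ann b \<delta>} \<Longrightarrow> skel enc a s \<gamma>' \<gamma> \<Longrightarrow>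
      flow_outcome d a \<gamma> s \<gamma>' b \<delta>"
    and IH': "\<And>a \<gamma> s \<gamma>' b \<delta>. concl d' = {ann (\<not> a) \<gamma>, ann b \<delta>} \<Longrightarrow> skel enc a s \<gamma>' \<gamma> \<Longrightarrow>
      flow_outcome d' a \<gamma> s \<gamma>' b \<delta>"
    and d: "concl d = set_option \<Theta> \<union> {R \<psi>}" "concl d' = {L \<psi>} \<union> set_option \<Xi>"
    and goal: "concl (Cut \<Theta> \<Xi> \<psi> d d') = {ann (\<not> a) \<gamma>, ann b \<delta>}" "ann (\<not> a) \<gamma> \<noteq> ann b \<delta>"
      "skel enc a s \<gamma>' \<gamma>" "s = SCons s1 s2"
  shows "flow_outcome (Cut \<Theta> \<Xi> \<psi> d d') a \<gamma> s \<gamma>' b \<delta>"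
proof -
  let ?e = "Cut \<Theta> \<Xi> \<psi> d d'"
  let ?B = "400 * dsize d + 400 * dsize d' + 100"
  have size: "dsize ?e = Suc (fsize \<gamma> + fsize \<delta> + dsize d + dsize d')"
    using goal(1) seq_size_two[OF goal(2)] by simp
  have cs: "\<Theta> = Some (ann (\<not> a) \<gamma>) \<and> \<Xi> = Some (ann b \<delta>) \<or>
      \<Theta> = Some (ann b \<delta>) \<and> \<Xi> = Some (ann (\<not> a) \<gamma>)"
    using options_two[OF _ goal(2)] goal(1) by simp
  then obtain \<Pi> where \<Pi>: "\<Theta> = Some \<Pi>" "\<Pi> \<in> concl ?e" by auto
  have "outcome 5 [enc_deriv enc ?e, enc_aform enc (ann (\<not> a) \<gamma>), s, enc_aform enc (ann b \<delta>),
      sbool (\<Pi> = ann (\<not> a) \<gamma>)] ?B a \<gamma>' b \<delta>"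
    using cs
  proof (elim disjE conjE)
    assume *: "\<Theta> = Some (ann (\<not> a) \<gamma>)" "\<Xi> = Some (ann b \<delta>)"
    have "concl d = {ann (\<not> a) \<gamma>, ann True \<psi>}" using d * by auto
    from IH[OF this goal(3)] obtain r \<psi>' n where r:
      "call interp 4 [enc_deriv enc d, enc_aform enc (ann (\<not> a) \<gamma>), s, node 1 [enc \<psi>]]
        = Some (r, n)" "n \<le> 400 * dsize d"
      "skel enc True r \<psi>' \<psi>" "fv \<psi>' \<subseteq> fv \<gamma>'" "provable {ann (\<not> a) \<gamma>', ann True \<psi>'}"
      unfolding ann_simps(1) enc_aform.simps by (rule outcomeE) simp
    have "concl d' = {ann (\<not> True) \<psi>, ann b \<delta>}" using d * by auto
    from IH'[OF this r(3)] obtain r' \<delta>' n' where r':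
      "call interp 4 [enc_deriv enc d', node 0 [enc \<psi>], r, enc_aform enc (ann b \<delta>)]
        = Some (r', n')" "n' \<le> 400 * dsize d'"
      "skel enc b r' \<delta>' \<delta>" "fv \<delta>' \<subseteq> fv \<psi>'" "provable {ann (\<not> True) \<psi>', ann b \<delta>'}"
      by (rule outcomeE) simp
    have "(\<Pi> = ann (\<not> a) \<gamma>) = True" using * \<Pi> by simp
    then show ?thesis
      using call_cut_left[OF r(1) r'(1), of "enc_opt enc \<Theta>" "enc_opt enc \<Xi>"] r(2,4) r'(2,3,4)
        provable_cut2[OF r(5) r'(5)]
      by (intro outcomeI[of _ _ r' _ _ \<delta>']) (fastforce simp del: ann_simps)+
  next
    assume *: "\<Theta> = Some (ann b \<delta>)" "\<Xi> = Some (ann (\<not> a) \<gamma>)"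
    have "concl d' = {ann (\<not> a) \<gamma>, ann False \<psi>}" using d * by auto
    from IH'[OF this goal(3)] obtain r \<psi>' n where r:
      "call interp 4 [enc_deriv enc d', enc_aform enc (ann (\<not> a) \<gamma>), s, node 0 [enc \<psi>]]
        = Some (r, n)" "n \<le> 400 * dsize d'"
      "skel enc False r \<psi>' \<psi>" "fv \<psi>' \<subseteq> fv \<gamma>'" "provable {ann (\<not> a) \<gamma>', ann False \<psi>'}"
      by (rule outcomeE) simp
    have "concl d = {ann (\<not> False) \<psi>, ann b \<delta>}" using d * by auto
    from IH[OF this r(3)] obtain r' \<delta>' n' where r':
      "call interp 4 [enc_deriv enc d, node 1 [enc \<psi>], r, enc_aform enc (ann b \<delta>)]
        = Some (r', n')" "n' \<le> 400 * dsize d"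
      "skel enc b r' \<delta>' \<delta>" "fv \<delta>' \<subseteq> fv \<psi>'" "provable {ann (\<not> False) \<psi>', ann b \<delta>'}"
      by (rule outcomeE) simp
    have "(\<Pi> = ann (\<not> a) \<gamma>) = False" using * \<Pi> goal(2) by (auto simp del: ann_simps)
    then show ?thesis
      using call_cut_right[OF r(1) r'(1), of "enc_opt enc \<Theta>" "enc_opt enc \<Xi>"] r(2,4) r'(2,3,4)
        provable_cut2[OF r(5) r'(5)]
      by (intro outcomeI[of _ _ r' _ _ \<delta>']) (fastforce simp del: ann_simps)+
  qed
  then show ?thesis
    using flow_outcome_step[OF goal(2,1,4), of 1 \<Pi>] \<Pi> size by simp
qed

lemma flow_weaken:
  assumes d: "is_proof d" "concl d = set_option \<Theta>"
    and goal: "concl (Weaken \<Theta> \<Xi> d) = {ann (\<not> a) \<gamma>, ann b \<delta>}" "ann (\<not> a) \<gamma> \<noteq> ann b \<delta>"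
      "skel enc a s \<gamma>' \<gamma>" "s = SCons s1 s2"
  shows "flow_outcome (Weaken \<Theta> \<Xi> d) a \<gamma> s \<gamma>' b \<delta>"
proof -
  let ?e = "Weaken \<Theta> \<Xi> d"
  have size: "dsize ?e = Suc (fsize \<gamma> + fsize \<delta> + dsize d)" "1 \<le> dsize d"
    using goal(1) seq_size_two[OF goal(2)] dsize_concl[of d] by simp_all
  have "\<Theta> = Some (ann (\<not> a) \<gamma>) \<or> \<Theta> = Some (ann b \<delta>)"
    using options_two[OF _ goal(2)] goal(1) by auto
  then obtain \<Pi> where \<Pi>: "\<Theta> = Some \<Pi>" "\<Pi> \<in> concl ?e" "\<Pi> = ann (\<not> a) \<gamma> \<or> \<Pi> = ann b \<delta>" by auto
  have \<Pi>_prov: "provable {\<Pi>}" using provableI[OF d] \<Pi>(1) by simp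
  have call: "\<exists>n. call interp 5 [enc_deriv enc ?e, enc_aform enc (ann (\<not> a) \<gamma>), s,
      enc_aform enc (ann b \<delta>), sbool q] = Some (sbool (\<not> q), n) \<and> n \<le> 100" for q
    using call_weaken by simp
  have "outcome 5 [enc_deriv enc ?e, enc_aform enc (ann (\<not> a) \<gamma>), s, enc_aform enc (ann b \<delta>),
      sbool (\<Pi> = ann (\<not> a) \<gamma>)] 100 a \<gamma>' b \<delta>"
  proof (cases "\<Pi> = ann (\<not> a) \<gamma>")
    case True
    with call[of True] \<Pi>_prov show ?thesis
      by (intro outcome_0[OF _ goal(3)]) (auto simp: sbool_def)
  next
    case False
    with call[of False] \<Pi>_prov \<Pi>(3) show ?thesis
      by (intro outcome_1) (auto simp: sbool_def)
  qed
  then show ?thesis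
    using flow_outcome_step[OF goal(2,1,4), of 2 \<Pi>] \<Pi> size by simp
qed

lemma flow_correct:
  "is_proof d \<Longrightarrow> concl d = {ann (\<not> a) \<gamma>, ann b \<delta>} \<Longrightarrow> skel enc a s \<gamma>' \<gamma> \<Longrightarrow>
   flow_outcome d a \<gamma> s \<gamma>' b \<delta>"
proof (induction d arbitrary: a \<gamma> s \<gamma>' b \<delta>)
  case (Hyp \<phi>)
  show ?case
  proof (rule flow_outcomeI[OF Hyp])
    fix s1 s2
    assume s: "s = SCons s1 s2" and ne: "ann (\<not> a) \<gamma> \<noteq> ann b \<delta>"
    \<comment> \<open>The sequent has one formula on each side, so source and target have the same
      flag and the skeleton can be handed over as it stands.\<close>
    from Hyp(2) have eq: "\<gamma> = \<phi>" "\<delta> = \<phi>" "b = a"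
      by (cases a; cases b; auto simp: doubleton_eq_iff)+
    have "dsize (Hyp \<phi>) = Suc (2 * fsize \<phi>)"
      using seq_size_two[of "L \<phi>" "R \<phi>"] by simp
    then have "20 * ssize (enc_aform enc (ann (\<not> a) \<gamma>)) + 20 \<le> 400 * dsize (Hyp \<phi>)"
      using enc_aform_size[of "ann (\<not> a) \<gamma>"] eq by simp
    moreover have "enc_aform enc (ann (\<not> a) \<gamma>) \<noteq> enc_aform enc (ann b \<delta>)"
      unfolding enc_aform_inj by (rule ne)
    ultimately have "\<exists>n. call interp 4 [enc_deriv enc (Hyp \<phi>), enc_aform enc (ann (\<not> a) \<gamma>), s,
        enc_aform enc (ann b \<delta>)] = Some (s, n) \<and> n \<le> 400 * dsize (Hyp \<phi>)"
      unfolding s enc_deriv.simps using call_flow_hyp le_trans by meson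
    moreover have "skel enc b s \<gamma>' \<delta>" using Hyp(3) eq by simp
    moreover have "provable {ann (\<not> a) \<gamma>', ann b \<gamma>'}" unfolding eq(3) by (rule provable_hyp)
    ultimately show "flow_outcome (Hyp \<phi>) a \<gamma> s \<gamma>' b \<delta>"
      by (intro outcomeI[of _ _ s _ _ \<gamma>']) auto
  qed
next
  case (Cut \<Theta> \<Xi> \<psi> d d')
  show ?case
    by (rule flow_outcomeI[OF Cut.prems], rule flow_cut[OF Cut.IH]) (use Cut.prems in auto)
next
  case (Weaken \<Theta> \<Xi> d)
  show ?case
    by (rule flow_outcomeI[OF Weaken.prems], rule flow_weaken) (use Weaken.prems in auto)
next
  case (LeftAnd \<Theta> \<phi> \<psi> d)
  show ?case
    by (rule flow_outcomeI[OF LeftAnd.prems],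
        rule flow_unary[OF LeftAnd.IH, where p = False and \<phi> = \<phi> and \<psi> = \<psi> and \<Theta> = \<Theta>])
      (use LeftAnd.prems in auto)
next
  case (RightAnd \<Theta> \<phi> \<psi> d d')
  show ?case
    by (rule flow_outcomeI[OF RightAnd.prems],
        rule flow_binary[OF RightAnd.IH, where p = True and \<phi> = \<phi> and \<psi> = \<psi> and \<Theta> = \<Theta>])
      (use RightAnd.prems in auto)
next
  case (LeftOr \<Theta> \<phi> \<psi> d d')
  show ?case
    by (rule flow_outcomeI[OF LeftOr.prems],
        rule flow_binary[OF LeftOr.IH, where p = False and \<phi> = \<phi> and \<psi> = \<psi> and \<Theta> = \<Theta>])
      (use LeftOr.prems in auto)
next
  case (RightOr \<Theta> \<phi> \<psi> d)
  show ?case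
    by (rule flow_outcomeI[OF RightOr.prems],
        rule flow_unary[OF RightOr.IH, where p = True and \<phi> = \<phi> and \<psi> = \<psi> and \<Theta> = \<Theta>])
      (use RightOr.prems in auto)
next
  case (LeftNot \<Theta> \<phi> d)
  show ?case
    by (rule flow_outcomeI[OF LeftNot.prems],
        rule flow_neg[OF LeftNot.IH, where p = True and \<phi> = \<phi> and \<Theta> = \<Theta>])
      (use LeftNot.prems in auto)
next
  case (RightNot \<Theta> \<phi> d)
  show ?case
    by (rule flow_outcomeI[OF RightNot.prems],
        rule flow_neg[OF RightNot.IH, where p = False and \<phi> = \<phi> and \<Theta> = \<Theta>])
      (use RightNot.prems in auto)
qed

lemma interp_correct:
  assumes "proves d (set_option \<Gamma> \<union> set_option \<Delta>)"
  shows "\<exists>I out t. runs interp (enc_input enc \<Gamma> \<Delta> d) out t \<and> t \<le> 1000 * dsize d \<and>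
    represents out I \<and> interpolant I \<Gamma> \<Delta>"
proof -
  from assms have d: "is_proof d" "concl d = set_option \<Gamma> \<union> set_option \<Delta>"
    by (auto simp: proves_def)
  note prov = provableI[OF d]
  have pos: "1 \<le> dsize d" using dsize_concl[of d] by simp
  show ?thesis
  proof (cases \<Gamma>)
    case None
    from call_main_left_None obtain n where
      "call interp 0 [enc_input enc \<Gamma> \<Delta> d] = Some (true_code, n)" "n \<le> 100"
      unfolding None enc_input_def by fastforce
    moreover have "interpolant (verum True) \<Gamma> \<Delta>"
      using interpolant_left_None prov None by simp
    ultimately show ?thesis
      using runs_interp represents_verum(1) size_verum_code(1) pos by fastforce
  next
    case \<Gamma>: (Some \<chi>)
    show ?thesis
    proof (cases \<Delta>)
      case None
      from call_main_right_None obtain n where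
        "call interp 0 [enc_input enc \<Gamma> \<Delta> d] = Some (false_code, n)" "n \<le> 100"
        unfolding \<Gamma> None enc_input_def by fastforce
      moreover have "interpolant (verum False) \<Gamma> \<Delta>"
        using interpolant_right_None prov None by simp
      ultimately show ?thesis
        using runs_interp represents_verum(2) size_verum_code(2) pos by fastforce
    next
      case \<Delta>: (Some \<theta>)
      obtain c \<gamma> where "\<chi> = ann c \<gamma>" using ex_ann by blast
      then obtain a where \<chi>: "\<chi> = ann (\<not> a) \<gamma>" using that[of "\<not> c"] by auto
      obtain b \<delta> where \<theta>: "\<theta> = ann b \<delta>" using ex_ann by blast
      have concl: "concl d = {ann (\<not> a) \<gamma>, ann b \<delta>}" using d(2) \<Gamma> \<Delta> \<chi> \<theta> by auto
      \<comment> \<open>Starting from the full code means \<open>\<gamma>' = \<gamma>\<close>, so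
        the invariant bounds the variables by those of \<open>\<gamma>\<close>; the bound by
        \<open>\<delta>\<close> comes from the result being a skeleton of it.\<close>
      from flow_correct[OF d(1) this skel_refl] obtain r \<delta>' n where r:
        "call interp 4 [enc_deriv enc d, enc_aform enc (ann (\<not> a) \<gamma>), enc \<gamma>,
          enc_aform enc (ann b \<delta>)] = Some (r, n)" "n \<le> 400 * dsize d"
        "skel enc b r \<delta>' \<delta>" "fv \<delta>' \<subseteq> fv \<gamma>" "provable {ann (\<not> a) \<gamma>, ann b \<delta>'}"
        by (rule outcomeE)
      from expand_skel[OF r(3)] obtain u m where u: "call interp 3 [r, sbool b] = Some (u, m)"
        "represents u \<delta>'" "m \<le> 100 * fsize \<delta>" "ssize u \<le> 20 * fsize \<delta>"
        by blast
      let ?I = "if b then \<delta>' else Neg \<delta>'"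
      let ?out = "if b then u else node 5 [u]"
      have "fsize \<delta> \<le> seq_size (concl d)"
        unfolding concl seq_size_def by (rule order_trans[OF _ member_le_sum[of "ann b \<delta>"]]) auto
      with dsize_concl[of d] have \<delta>_size: "fsize \<delta> \<le> dsize d" by simp
      obtain l where l: "call interp 0 [enc_input enc \<Gamma> \<Delta> d] = Some (?out, l)" "l \<le> n + m + 100"
        using call_main[OF r(1)[unfolded enc_aform_ann] u(1)]
        unfolding \<Gamma> \<Delta> \<chi> \<theta> enc_input_def enc_opt.simps enc_aform_ann by blast
      have "ssize ?out \<le> 20 * dsize d + 5"
        using u(4) \<delta>_size by (simp add: node_def)
      \<comment> \<open>The flow contributes 400, the expansion 100 and the output 20 per unit of
        \<open>dsize\<close>; the remaining constants are absorbed because \<open>dsize d\<close> is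
        positive.\<close>
      then have "l + ssize ?out \<le> 1000 * dsize d"
        using l(2) r(2) u(3) \<delta>_size pos by linarith
      moreover have "represents ?out ?I"
        using u(2) by (auto intro: represents.intros)
      moreover have "interpolant ?I \<Gamma> \<Delta>"
        unfolding \<Gamma> \<Delta> \<chi> \<theta>
        using r(4,5) skel_provable[OF r(3)] skel_fv[OF r(3)] by (intro interpolant_ann) auto
      ultimately show ?thesis using runs_interp[OF l(1)] by blast
    qed
  qed
qed

end

theorem theorem4:
  shows "\<exists>(p :: program) (c :: nat).
    \<forall>(enc :: form \<Rightarrow> sexp) (\<Gamma> :: aform option) (\<Delta> :: aform option) (d :: deriv).
      coding enc \<longrightarrow> proves d (set_option \<Gamma> \<union> set_option \<Delta>) \<longrightarrow>
      (\<exists>(I :: form) (out :: sexp) (t :: nat).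
         runs p (enc_input enc \<Gamma> \<Delta> d) out t \<and> t \<le> c * dsize d \<and>
         represents out I \<and> interpolant I \<Gamma> \<Delta>)"
  using coded.interp_correct[OF coded.intro] by blast

end
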